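(* Let $W=\{W(t):t\in[a,b]\}$ be a Brownian motion and let $L$ be the weak random operator $\langle Lf,h\rangle:=\varepsilon(f,h)=-\int_a^b f'(t)h'(t)\,dt+\int_a^b f(t)h'(t)W(t)\,dt$. Let $u,v$ be two solutions of $Lf=0$ such that $u(a)=0$, $u(b)=1$, $v(a)=1$ and $v(b)=0$ always. Set $\alpha(t):=u'(t)v(t)-v'(t)u(t)$, $$G(t,s):=\begin{cases}\dfrac{u(t)v(s)}{\alpha(s)}, & a\le s\le t\le b,\\[2mm] \dfrac{u(s)v(t)}{\alpha(s)}, & a\le t\le s\le b,\end{cases}$$ and define the stochastic Green operator associated to $L$ by $$(Tf)(t):=\int_a^b G(t,s)f(s)\,ds,\qquad f\in L_2[a,b].$$ Then $T$ is the right inverse of $L$ in the sense that, for all $f\in L_2[a,b]$ and all $h\in H_1$, $$\varepsilon(Tf,h)=\langle LTf,h\rangle=\langle f,h\rangle\quad\text{almost surely.}$$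
   Context: Fix real numbers $a<b$ and a Brownian motion $W=\{W(t):t\in[a,b]\}$ with continuous paths. Write $\langle f,g\rangle=\int_a^b f(x)g(x)\,dx$ for the inner product of $L_2[a,b]$. Let $H_1$ be the Sobolev space of absolutely continuous functions $h:[a,b]\to\mathbb{R}$ with $h,h'\in L_2[a,b]$ and $h(a)=h(b)=0$. The operator $L$ is formally $(Lf)(t)=f''(t)-W(t)f'(t)-W'(t)f(t)$; it is given rigorous meaning only through the bilinear form $$\langle Lf,h\rangle:=\varepsilon(f,h):=-\int_a^b f'(t)h'(t)\,dt+\int_a^b f(t)h'(t)W(t)\,dt .$$ The form is defined for $f,h\in H_1$, and the same formula is used for $h\in H_1$ and for $f$ absolutely continuous with $f'\in L_2[a,b]$, without boundary conditions on $f$. A stochastic process $\{u(t):t\in[a,b]\}$ with absolutely continuous paths and $u'\in L_2[a,b]$ is called a solution of $Lf=0$ if for all $h\in H_1$, $\varepsilon(u,h)=0$ almost surely. *)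

theory Defs
  imports "HOL-Probability.Probability"
begin

definition L2_on :: "real \<Rightarrow> real \<Rightarrow> (real \<Rightarrow> real) set" where
  "L2_on a b = {f. f \<in> borel_measurable (lebesgue_on {a..b}) \<and>
                   integrable (lebesgue_on {a..b}) (\<lambda>x. (f x)\<^sup>2)}"

definition L2_inner :: "real \<Rightarrow> real \<Rightarrow> (real \<Rightarrow> real) \<Rightarrow> (real \<Rightarrow> real) \<Rightarrow> real" where
  "L2_inner a b f g = (LINT x|lebesgue_on {a..b}. f x * g x)"

text \<open>Absolute continuity on the interval from a to b, in the usual epsilon-delta form:
  \<open>l i\<close> and \<open>r i\<close> are the endpoints of finitely many non-overlapping subintervals.\<close>

definition abs_cont_on :: "real \<Rightarrow> real \<Rightarrow> (real \<Rightarrow> real) \<Rightarrow> bool" where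
  "abs_cont_on a b f \<longleftrightarrow>
     (\<forall>e>0. \<exists>d>0. \<forall>(n::nat) (l::nat \<Rightarrow> real) (r::nat \<Rightarrow> real).
        (\<forall>i<n. a \<le> l i \<and> l i \<le> r i \<and> r i \<le> b) \<longrightarrow>
        (\<forall>i<n. \<forall>j<n. i \<noteq> j \<longrightarrow> {l i<..<r i} \<inter> {l j<..<r j} = {}) \<longrightarrow>
        (\<Sum>i<n. r i - l i) < d \<longrightarrow>
        (\<Sum>i<n. \<bar>f (r i) - f (l i)\<bar>) < e)"

text \<open>The derivative of an absolutely continuous function exists almost everywhere only;
  \<^term>\<open>deriv f\<close> takes an unspecified value at the remaining points (and possibly at the
  endpoints), which affects none of the integrals below.\<close>

definition form_dom :: "real \<Rightarrow> real \<Rightarrow> (real \<Rightarrow> real) set" where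
  "form_dom a b = {f. abs_cont_on a b f \<and> deriv f \<in> L2_on a b}"

definition H1 :: "real \<Rightarrow> real \<Rightarrow> (real \<Rightarrow> real) set" where
  "H1 a b = {h. abs_cont_on a b h \<and> h \<in> L2_on a b \<and> deriv h \<in> L2_on a b \<and> h a = 0 \<and> h b = 0}"

text \<open>In the following two definitions \<open>w\<close> is one path of the Brownian motion.\<close>

definition weak_form ::
  "real \<Rightarrow> real \<Rightarrow> (real \<Rightarrow> real) \<Rightarrow> (real \<Rightarrow> real) \<Rightarrow> (real \<Rightarrow> real) \<Rightarrow> real" where
  "weak_form a b w f h =
     - (LINT t|lebesgue_on {a..b}. deriv f t * deriv h t)
     + (LINT t|lebesgue_on {a..b}. f t * deriv h t * w t)"

text \<open>\<open>weak_L a b w f\<close> is the linear functional \<open>h \<mapsto> \<langle>Lf,h\<rangle>\<close>; the formal second order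
  expression for L has no meaning of its own.\<close>

definition weak_L ::
  "real \<Rightarrow> real \<Rightarrow> (real \<Rightarrow> real) \<Rightarrow> (real \<Rightarrow> real) \<Rightarrow> ((real \<Rightarrow> real) \<Rightarrow> real)" where
  "weak_L a b w f = (\<lambda>h. weak_form a b w f h)"

text \<open>Processes take the time first and the sample point second. The value of the Brownian motion
  at the left endpoint is left unspecified, so that a Brownian motion started at time a and the
  restriction to the interval of a one- or two-sided Brownian motion are both covered.\<close>

definition brownian_motion_on ::
  "'w measure \<Rightarrow> real \<Rightarrow> real \<Rightarrow> (real \<Rightarrow> 'w \<Rightarrow> real) \<Rightarrow> bool" where
  "brownian_motion_on M a b W \<longleftrightarrow>
     (\<forall>t\<in>{a..b}. W t \<in> borel_measurable M) \<and>
     (\<forall>(n::nat) (\<tau>::nat \<Rightarrow> real).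
        (\<forall>i\<le>n. \<tau> i \<in> {a..b}) \<longrightarrow> (\<forall>i<n. \<tau> i < \<tau> (Suc i)) \<longrightarrow>
        prob_space.indep_vars M (\<lambda>_. borel) (\<lambda>i \<omega>. W (\<tau> (Suc i)) \<omega> - W (\<tau> i) \<omega>) {..<n}) \<and>
     (\<forall>s\<in>{a..b}. \<forall>t\<in>{a..b}. s < t \<longrightarrow>
        distributed M lborel (\<lambda>\<omega>. W t \<omega> - W s \<omega>) (normal_density 0 (sqrt (t - s)))) \<and>
     (\<forall>\<omega>\<in>space M. continuous_on {a..b} (\<lambda>t. W t \<omega>))"

definition weak_solution ::
  "'w measure \<Rightarrow> real \<Rightarrow> real \<Rightarrow> (real \<Rightarrow> 'w \<Rightarrow> real) \<Rightarrow> (real \<Rightarrow> 'w \<Rightarrow> real) \<Rightarrow> bool" where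
  "weak_solution M a b W u \<longleftrightarrow>
     (\<forall>t\<in>{a..b}. u t \<in> borel_measurable M) \<and>
     (\<forall>\<omega>\<in>space M. (\<lambda>t. u t \<omega>) \<in> form_dom a b) \<and>
     (\<forall>h\<in>H1 a b. AE \<omega> in M. weak_L a b (\<lambda>t. W t \<omega>) (\<lambda>t. u t \<omega>) h = 0)"

text \<open>In the following definitions \<open>u\<close> and \<open>v\<close> are single paths of the two solutions.\<close>

definition green_alpha :: "(real \<Rightarrow> real) \<Rightarrow> (real \<Rightarrow> real) \<Rightarrow> real \<Rightarrow> real" where
  "green_alpha u v t = deriv u t * v t - deriv v t * u t"

definition green_kernel :: "(real \<Rightarrow> real) \<Rightarrow> (real \<Rightarrow> real) \<Rightarrow> real \<Rightarrow> real \<Rightarrow> real" where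
  "green_kernel u v t s =
     (if s \<le> t then u t * v s / green_alpha u v s else u s * v t / green_alpha u v s)"

definition green_op ::
  "real \<Rightarrow> real \<Rightarrow> (real \<Rightarrow> real) \<Rightarrow> (real \<Rightarrow> real) \<Rightarrow> (real \<Rightarrow> real) \<Rightarrow> real \<Rightarrow> real" where
  "green_op a b u v f t = (LINT s|lebesgue_on {a..b}. green_kernel u v t s * f s)"

end

theory Submission
  imports Defs
begin

text \<open>Almost surely, a solution \<open>u\<close> passes the test against a countable family of piecewise linear
  functions, hence \<open>u' - u w = c\<close> for a constant \<open>c\<close>, where \<open>w\<close> is the Brownian path; likewise
  \<open>v' - v w = d\<close>. Therefore \<open>\<alpha> = c v - d u\<close> solves \<open>\<alpha>' = w \<alpha>\<close>, and the boundary values exclude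
  \<open>c = 0\<close>, so \<open>\<alpha>\<close> has no zero. With \<open>A(t) = \<integral>\<^sub>a\<^sup>t v f / \<alpha>\<close> and \<open>B(t) = \<integral>\<^sub>t\<^sup>b u f / \<alpha>\<close> one has
  \<open>T f = u A + v B\<close> and \<open>(T f)' = u' A + v' B\<close>, whence \<open>(T f)' - w T f = c A + d B\<close>, a function with
  derivative \<open>f\<close>. Integrating by parts against \<open>h\<close> gives the claim.

  Both the passage to the differential equation and the integration by parts need Lebesgue's theorem
  that an absolutely continuous function is the integral of its derivative. The positive variation
  reduces it to monotone functions, for which the Stieltjes measure has a Radon-Nikodym density.\<close>

section \<open>Positive variation of absolutely continuous functions\<close>

text \<open>The exceptional null set of a weak solution depends on the test function, while the
  differential equation needs all tests on a single event; hence the care to use only countably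
  many. Once the equation holds along a path, continuity of \<open>w\<close> makes it classical:
  \<open>u\<close> and \<open>v\<close> are continuously differentiable, so \<open>\<alpha>\<close>
  is continuous without zeros on a compact interval, and dividing by it keeps \<open>v f\<close> and
  \<open>u f\<close> square integrable. The shape of \<open>A\<close> and \<open>B\<close> is
  variation of constants, chosen so that \<open>u A' + v B' = 0\<close>. Since \<open>f\<close> is
  only square integrable, \<open>A\<close> and \<open>B\<close> are in general differentiable only
  almost everywhere; the identities are therefore proved in integrated form, with Fubini on a
  triangle in place of the product rule. The same Fubini formula serves for \<open>h\<close>, whose
  derivative is also only square integrable.\<close>

definition interval_family ::
  "real \<Rightarrow> real \<Rightarrow> 'i set \<Rightarrow> ('i \<Rightarrow> real) \<Rightarrow> ('i \<Rightarrow> real) \<Rightarrow> bool" where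
  "interval_family x y I l r \<longleftrightarrow> finite I \<and> (\<forall>i\<in>I. x \<le> l i \<and> l i \<le> r i \<and> r i \<le> y) \<and>
     disjoint_family_on (\<lambda>i. {l i<..<r i}) I"

text \<open>A bijection with \<open>{..<card I}\<close> transports the condition to families over
  any index type. The freedom is used below: pairs index the refinement of a family, and the
  components of an open set index themselves.\<close>

lemma abs_cont_on_family:
  assumes "abs_cont_on a b f" "e > 0"
  obtains d where "d > 0"
    "\<And>(I::'i set) l r. interval_family a b I l r \<Longrightarrow> (\<Sum>i\<in>I. r i - l i) < d
        \<Longrightarrow> (\<Sum>i\<in>I. \<bar>f (r i) - f (l i)\<bar>) < e"
proof -
  obtain d where d: "d > 0" and D: "\<And>(n::nat) l r. (\<forall>i<n. a \<le> l i \<and> l i \<le> r i \<and> r i \<le> b) \<Longrightarrow>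
        (\<forall>i<n. \<forall>j<n. i \<noteq> j \<longrightarrow> {l i<..<r i} \<inter> {l j<..<r j} = {}) \<Longrightarrow>
        (\<Sum>i<n. r i - l i) < d \<Longrightarrow> (\<Sum>i<n. \<bar>f (r i) - f (l i)\<bar>) < e"
    using assms unfolding abs_cont_on_def by blast
  have "(\<Sum>i\<in>I. \<bar>f (r i) - f (l i)\<bar>) < e"
    if F: "interval_family a b I l r" and S: "(\<Sum>i\<in>I. r i - l i) < d" for I :: "'i set" and l r
  proof -
    have "finite I" using F by (simp add: interval_family_def)
    then obtain p where p: "bij_betw p {..<card I} I"
      using ex_bij_betw_nat_finite[of I] by (auto simp: lessThan_atLeast0)
    then have pI: "p i \<in> I" if "i < card I" for i
      using that by (auto simp: bij_betw_def)
    have pne: "p i \<noteq> p j" if "i < card I" "j < card I" "i \<noteq> j" for i j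
      using p that by (auto simp: bij_betw_def inj_on_def)
    have "(\<Sum>i<card I. \<bar>f (r (p i)) - f (l (p i))\<bar>) < e"
    proof (rule D)
      show "\<forall>i<card I. a \<le> l (p i) \<and> l (p i) \<le> r (p i) \<and> r (p i) \<le> b"
        using F pI by (auto simp: interval_family_def)
      show "\<forall>i<card I. \<forall>j<card I. i \<noteq> j \<longrightarrow>
          {l (p i)<..<r (p i)} \<inter> {l (p j)<..<r (p j)} = {}"
        using F pI pne unfolding interval_family_def disjoint_family_on_def by metis
      show "(\<Sum>i<card I. r (p i) - l (p i)) < d"
        using S sum.reindex_bij_betw[OF p, of "\<lambda>i. r i - l i"] by simp
    qed
    then show ?thesis
      using sum.reindex_bij_betw[OF p, of "\<lambda>i. \<bar>f (r i) - f (l i)\<bar>"] by simp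
  qed
  with d that show thesis by blast
qed

lemma interval_family_subset:
  assumes "interval_family x y I l r"
    and "\<And>i. i \<in> I \<Longrightarrow> x' \<le> l' i \<and> l' i \<le> r' i \<and> r' i \<le> y'"
    and "\<And>i. i \<in> I \<Longrightarrow> {l' i<..<r' i} \<subseteq> {l i<..<r i}"
  shows "interval_family x' y' I l' r'"
proof -
  have "disjoint_family_on (\<lambda>i. {l i<..<r i}) I" "finite I"
    using assms(1) by (auto simp: interval_family_def)
  then have "disjoint_family_on (\<lambda>i. {l' i<..<r' i}) I"
    using assms(3) unfolding disjoint_family_on_def by blast
  with \<open>finite I\<close> assms(2) show ?thesis by (auto simp: interval_family_def)
qed

lemma interval_familyD:
  assumes "interval_family x y I l r" "i \<in> I"
  shows "x \<le> l i" "l i \<le> r i" "r i \<le> y"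
  using assms by (auto simp: interval_family_def)

lemma interval_family_mono:
  assumes F: "interval_family x' y' I l r" and "x \<le> x'" "y' \<le> y"
  shows "interval_family x y I l r"
proof (rule interval_family_subset[OF F])
  show "x \<le> l i \<and> l i \<le> r i \<and> r i \<le> y" if "i \<in> I" for i
    using interval_familyD[OF F that] assms by linarith
qed simp

text \<open>Additivity and monotonicity of Lebesgue measure spare the sorting of the
  intervals.\<close>

lemma interval_family_length:
  assumes "interval_family x y I l r" "x \<le> y"
  shows "(\<Sum>i\<in>I. r i - l i) \<le> y - x"
proof -
  have fin: "finite I" using assms by (simp add: interval_family_def)
  have "(\<Sum>i\<in>I. r i - l i) = (\<Sum>i\<in>I. measure lborel {l i<..<r i})"
    using assms by (intro sum.cong) (auto simp: interval_family_def)
  also have "\<dots> = measure lborel (\<Union>i\<in>I. {l i<..<r i})"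
    using assms fin by (subst measure_finite_Union) (auto simp: interval_family_def)
  also have "\<dots> \<le> measure lborel {x..y}"
  proof (rule measure_mono_fmeasurable)
    show "(\<Union>i\<in>I. {l i<..<r i}) \<subseteq> {x..y}"
      using assms by (force simp: interval_family_def)
    show "(\<Union>i\<in>I. {l i<..<r i}) \<in> sets lborel"
      using fin by (intro sets.finite_UN) auto
    show "{x..y} \<in> fmeasurable lborel"
      by (simp add: fmeasurable_def emeasure_lborel_Icc_eq)
  qed
  finally show ?thesis using assms by simp
qed

text \<open>The increments keep their sign and the intervals need not cover \<open>{x..y}\<close>:
  pieces on which \<open>f\<close> decreases can be left out, so the supremum is the positive
  variation.\<close>

definition incr_sums :: "(real \<Rightarrow> real) \<Rightarrow> real \<Rightarrow> real \<Rightarrow> real set" where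
  "incr_sums f x y = {(\<Sum>i\<in>I. f (r i) - f (l i)) | (I :: nat set) l r. interval_family x y I l r}"

lemma incr_sumsI:
  "interval_family x y (I :: nat set) l r \<Longrightarrow> (\<Sum>i\<in>I. f (r i) - f (l i)) \<in> incr_sums f x y"
  unfolding incr_sums_def by blast

lemma incr_sums_0: "0 \<in> incr_sums f x y"
  unfolding incr_sums_def by (rule CollectI, rule exI[of _ "{}"]) (auto simp: interval_family_def disjoint_family_on_def)

lemma incr_sums_append:
  assumes "s \<in> incr_sums f a x" "a \<le> x" "x \<le> y"
  shows "s + (f y - f x) \<in> incr_sums f a y"
proof -
  obtain I :: "nat set" and l r where s: "s = (\<Sum>i\<in>I. f (r i) - f (l i))" and F: "interval_family a x I l r"
    using assms unfolding incr_sums_def by auto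
  have fin: "finite I" using F by (simp add: interval_family_def)
  obtain k where k: "k \<notin> I"
    using ex_new_if_finite[OF infinite_UNIV_nat fin] by blast
  let ?l = "l(k := x)" and ?r = "r(k := y)"
  have eq: "\<And>i. i \<in> I \<Longrightarrow> ?l i = l i \<and> ?r i = r i"
    using k by auto
  have F': "interval_family a y I ?l ?r"
  proof (rule interval_family_subset[OF F])
    show "a \<le> ?l i \<and> ?l i \<le> ?r i \<and> ?r i \<le> y" if "i \<in> I" for i
      using interval_familyD[OF F that] eq[OF that] assms by linarith
  qed (use eq in auto)
  have "{?l k<..<?r k} \<inter> (\<Union>i\<in>I. {?l i<..<?r i}) = {}"
    using interval_familyD[OF F] eq by fastforce
  then have "disjoint_family_on (\<lambda>i. {?l i<..<?r i}) (insert k I)"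
    using disjoint_family_on_insert[OF k, of "\<lambda>i. {?l i<..<?r i}"] F' by (simp add: interval_family_def)
  then have "interval_family a y (insert k I) ?l ?r"
    using F' assms unfolding interval_family_def by simp
  moreover have "s + (f y - f x) = (\<Sum>i\<in>insert k I. f (?r i) - f (?l i))"
  proof -
    have "(\<Sum>i\<in>I. f (?r i) - f (?l i)) = s"
      unfolding s using eq by (intro sum.cong) auto
    then show ?thesis using fin k by simp
  qed
  ultimately show ?thesis
    unfolding incr_sums_def by blast
qed

text \<open>Each interval is cut at \<open>x\<close>, with \<open>min _ x\<close> giving the left
  part and \<open>max _ x\<close> the right part. An interval on one side of \<open>x\<close>
  becomes degenerate in the family of the other side and contributes 0 there.\<close>

lemma incr_sums_split:
  assumes "s \<in> incr_sums f a y" "a \<le> x" "x \<le> y"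
  obtains s1 s2 where "s1 \<in> incr_sums f a x" "s2 \<in> incr_sums f x y" "s = s1 + s2"
proof -
  obtain I :: "nat set" and l r where s: "s = (\<Sum>i\<in>I. f (r i) - f (l i))" and F: "interval_family a y I l r"
    using assms unfolding incr_sums_def by auto
  let ?s1 = "\<Sum>i\<in>I. f (min (r i) x) - f (min (l i) x)"
  let ?s2 = "\<Sum>i\<in>I. f (max (r i) x) - f (max (l i) x)"
  have "interval_family a x I (\<lambda>i. min (l i) x) (\<lambda>i. min (r i) x)"
  proof (rule interval_family_subset[OF F])
    fix i assume i: "i \<in> I"
    note D = interval_familyD[OF F i]
    show "a \<le> min (l i) x \<and> min (l i) x \<le> min (r i) x \<and> min (r i) x \<le> x"
      using D assms by (auto simp: min_def)
    show "{min (l i) x<..<min (r i) x} \<subseteq> {l i<..<r i}"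
      by (auto simp: min_def split: if_splits)
  qed
  then have 1: "?s1 \<in> incr_sums f a x" by (rule incr_sumsI)
  have "interval_family x y I (\<lambda>i. max (l i) x) (\<lambda>i. max (r i) x)"
  proof (rule interval_family_subset[OF F])
    fix i assume i: "i \<in> I"
    note D = interval_familyD[OF F i]
    show "x \<le> max (l i) x \<and> max (l i) x \<le> max (r i) x \<and> max (r i) x \<le> y"
      using D assms by (auto simp: max_def)
    show "{max (l i) x<..<max (r i) x} \<subseteq> {l i<..<r i}"
      by (auto simp: max_def split: if_splits)
  qed
  then have 2: "?s2 \<in> incr_sums f x y" by (rule incr_sumsI)
  have "s = ?s1 + ?s2"
    unfolding s sum.distrib[symmetric] by (intro sum.cong) (auto simp: min_def max_def)
  with 1 2 that show thesis by blast
qed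

text \<open>On an interval shorter than the \<open>d\<close> that belongs to the error 1, every sum
  is at most 1. Finitely many such intervals cover \<open>{a..b}\<close>, and sums can be split at
  their endpoints; this is the induction over \<open>k\<close>.\<close>

lemma incr_sums_bounded:
  assumes "abs_cont_on a b f"
  shows "\<exists>C. \<forall>s\<in>incr_sums f a b. s \<le> C"
proof -
  obtain d where d: "d > 0" and D: "\<And>(I::nat set) l r. interval_family a b I l r \<Longrightarrow> (\<Sum>i\<in>I. r i - l i) < d
        \<Longrightarrow> (\<Sum>i\<in>I. \<bar>f (r i) - f (l i)\<bar>) < 1"
    using abs_cont_on_family[OF assms, of 1, where 'i = nat] by (metis zero_less_one)
  have short: "s \<le> 1" if xy: "s \<in> incr_sums f x y" "a \<le> x" "x \<le> y" "y \<le> b" "y - x < d" for s x y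
  proof -
    obtain I :: "nat set" and l r where s: "s = (\<Sum>i\<in>I. f (r i) - f (l i))" and F: "interval_family x y I l r"
      using xy unfolding incr_sums_def by auto
    have "s \<le> (\<Sum>i\<in>I. \<bar>f (r i) - f (l i)\<bar>)"
      unfolding s by (intro sum_mono) auto
    also have "\<dots> < 1"
    proof (rule D)
      show "interval_family a b I l r"
        using interval_family_mono[OF F] xy by simp
      show "(\<Sum>i\<in>I. r i - l i) < d"
        using interval_family_length[OF F] that by linarith
    qed
    finally show ?thesis by simp
  qed
  have main: "\<forall>y. a \<le> y \<and> y \<le> b \<and> y \<le> a + real k * (d/2) \<longrightarrow> (\<forall>s\<in>incr_sums f a y. s \<le> real k + 1)" for k
  proof (induction k)
    case 0
    then show ?case using short[of _ a] d by auto
  next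
    case (Suc k)
    show ?case
    proof (intro allI impI ballI)
      fix y s
      assume y: "a \<le> y \<and> y \<le> b \<and> y \<le> a + real (Suc k) * (d/2)" and s: "s \<in> incr_sums f a y"
      \<comment> \<open>Steps of \<open>d/2\<close> rather than \<open>d\<close>, because the length
        of a family must stay strictly below \<open>d\<close>.\<close>
      define x where "x = max a (y - d/2)"
      have x: "a \<le> x" "x \<le> y" "y - x < d" "x \<le> a + real k * (d/2)"
        using y d by (auto simp: x_def max_def field_simps)
      obtain s1 s2 where "s1 \<in> incr_sums f a x" "s2 \<in> incr_sums f x y" "s = s1 + s2"
        using incr_sums_split[OF s x(1,2)] by blast
      moreover from this have "s1 \<le> real k + 1" "s2 \<le> 1"
        using Suc.IH x y short by auto
      ultimately show "s \<le> real (Suc k) + 1" by simp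
    qed
  qed
  show ?thesis
  proof (cases "a \<le> b")
    case True
    obtain k :: nat where "(b - a) / (d/2) < real k" using reals_Archimedean2 by blast
    then have "b \<le> a + real k * (d/2)" using d by (simp add: field_simps)
    then show ?thesis using main[of k] True by blast
  next
    case False
    have "s \<le> 0" if s: "s \<in> incr_sums f a b" for s
    proof -
      obtain I :: "nat set" and l r where "s = (\<Sum>i\<in>I. f (r i) - f (l i))" "interval_family a b I l r"
        using s unfolding incr_sums_def by auto
      moreover from this have "I = {}"
        using False unfolding interval_family_def by force
      ultimately show ?thesis by simp
    qed
    then show ?thesis by blast
  qed
qed

lemma incr_sums_mono:
  assumes "x \<le> x'" "y' \<le> y"
  shows "incr_sums f x' y' \<subseteq> incr_sums f x y"
proof -
  have "interval_family x y I l r" if F: "interval_family x' y' I l r" for I :: "nat set" and l r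
    using interval_family_mono[OF F assms] .
  then show ?thesis unfolding incr_sums_def by blast
qed

definition pos_var :: "(real \<Rightarrow> real) \<Rightarrow> real \<Rightarrow> real \<Rightarrow> real" where
  "pos_var f a x = Sup (incr_sums f a x)"

lemma bdd_above_incr_sums:
  assumes "abs_cont_on a b f" "a \<le> x" "y \<le> b"
  shows "bdd_above (incr_sums f x y)"
  using incr_sums_bounded[OF assms(1)] incr_sums_mono[OF assms(2,3), of f]
  unfolding bdd_above_def by blast

text \<open>Together with \<open>pos_var_mono\<close> this yields the Jordan decomposition: both
  \<open>pos_var f a\<close> and \<open>pos_var f a - f\<close> are monotone.\<close>

lemma pos_var_diff_ge:
  assumes "abs_cont_on a b f" "a \<le> x" "x \<le> y" "y \<le> b"
  shows "pos_var f a y - pos_var f a x \<ge> f y - f x"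
proof -
  have "pos_var f a x \<le> pos_var f a y - (f y - f x)"
    unfolding pos_var_def
  proof (rule cSup_least)
    show "incr_sums f a x \<noteq> {}" using incr_sums_0 by blast
    fix s assume s: "s \<in> incr_sums f a x"
    show "s \<le> Sup (incr_sums f a y) - (f y - f x)"
      using cSup_upper[OF incr_sums_append[OF s assms(2,3)] bdd_above_incr_sums[OF assms(1) _ assms(4)]]
      by simp
  qed
  then show ?thesis by simp
qed

lemma pos_var_mono:
  assumes "abs_cont_on a b f" "x \<le> y" "y \<le> b"
  shows "pos_var f a x \<le> pos_var f a y"
  unfolding pos_var_def
  using incr_sums_0[of f a x] incr_sums_mono[OF order_refl assms(2)] bdd_above_incr_sums[OF assms(1) order_refl assms(3)]
  by (intro cSup_subset_mono) blast+

text \<open>A nearly optimal sum on \<open>{a..y}\<close> is split at \<open>x\<close>. Its left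
  part cannot exceed \<open>pos_var f a x\<close>, so the right part accounts for the growth up to
  \<open>\<eta>\<close>.\<close>

lemma pos_var_diff_le:
  assumes "abs_cont_on a b f" "a \<le> x" "x \<le> y" "y \<le> b" "\<eta> > 0"
  obtains s where "s \<in> incr_sums f x y" "pos_var f a y - pos_var f a x < s + \<eta>"
proof -
  have "\<exists>s\<in>incr_sums f a y. Sup (incr_sums f a y) - \<eta> < s"
    by (rule less_cSupD) (use incr_sums_0 assms(5) in auto)
  then obtain s where s: "s \<in> incr_sums f a y" "Sup (incr_sums f a y) - \<eta> < s" by blast
  obtain s1 s2 where s12: "s1 \<in> incr_sums f a x" "s2 \<in> incr_sums f x y" "s = s1 + s2"
    using incr_sums_split[OF s(1) assms(2,3)] by blast
  have "s1 \<le> pos_var f a x"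
    unfolding pos_var_def using assms by (intro cSup_upper[OF s12(1)] bdd_above_incr_sums[OF assms(1)]) auto
  then show thesis using that[OF s12(2)] s s12(3) by (simp add: pos_var_def)
qed

text \<open>Each increment of \<open>pos_var f a\<close> is nearly exhausted by a sum of
  \<open>f\<close> over a family inside the interval concerned. The union of these families, indexed
  by pairs, refines the given one and is no longer than it, so the condition for \<open>f\<close>
  applies to it.\<close>

lemma abs_cont_on_pos_var:
  assumes "abs_cont_on a b f"
  shows "abs_cont_on a b (pos_var f a)"
  unfolding abs_cont_on_def
proof (intro allI impI)
  fix e :: real assume "e > 0"
  then have "e/2 > 0" by simp
  then obtain d where d: "d > 0" and D: "\<And>(I::(nat\<times>nat) set) l r. interval_family a b I l r
      \<Longrightarrow> (\<Sum>i\<in>I. r i - l i) < d \<Longrightarrow> (\<Sum>i\<in>I. \<bar>f (r i) - f (l i)\<bar>) < e/2"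
    using abs_cont_on_family[OF assms, where 'i = "nat\<times>nat"] by metis
  have "(\<Sum>i<n. \<bar>pos_var f a (r i) - pos_var f a (l i)\<bar>) < e"
    if lr: "\<forall>i<n. a \<le> l i \<and> l i \<le> r i \<and> r i \<le> b"
      and dis: "\<forall>i<n. \<forall>j<n. i \<noteq> j \<longrightarrow> {l i<..<r i} \<inter> {l j<..<r j} = {}"
      and len: "(\<Sum>i<n. r i - l i) < d" for n :: nat and l r
  proof (cases "n = 0")
    case True then show ?thesis using \<open>e > 0\<close> by simp
  next
    case n: False
    \<comment> \<open>The \<open>n\<close> approximation errors add up to \<open>e/2\<close>; the
      other half of \<open>e\<close> bounds the sum over the refinement.\<close>
    define \<eta> where "\<eta> = e / (2 * real n)"
    have \<eta>: "\<eta> > 0" using \<open>e > 0\<close> n by (simp add: \<eta>_def)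
    have "\<exists>s\<in>incr_sums f (l i) (r i). pos_var f a (r i) - pos_var f a (l i) < s + \<eta>" if "i < n" for i
    proof -
      have i: "a \<le> l i" "l i \<le> r i" "r i \<le> b" using lr that by auto
      show ?thesis by (rule pos_var_diff_le[OF assms i \<eta>]) blast
    qed
    then have "\<forall>i. \<exists>I L R. i < n \<longrightarrow> interval_family (l i) (r i) (I::nat set) L R \<and>
        pos_var f a (r i) - pos_var f a (l i) < (\<Sum>j\<in>I. f (R j) - f (L j)) + \<eta>"
      unfolding incr_sums_def by blast
    then have "\<exists>I L R. \<forall>i. i < n \<longrightarrow> interval_family (l i) (r i) (I i::nat set) (L i) (R i) \<and>
        pos_var f a (r i) - pos_var f a (l i) < (\<Sum>j\<in>I i. f (R i j) - f (L i j)) + \<eta>"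
      unfolding choice_iff .
    then obtain I L R where F: "\<And>i. i < n \<Longrightarrow> interval_family (l i) (r i) (I i::nat set) (L i) (R i)"
      and S: "\<And>i. i < n \<Longrightarrow> pos_var f a (r i) - pos_var f a (l i) < (\<Sum>j\<in>I i. f (R i j) - f (L i j)) + \<eta>"
      by blast
    let ?J = "Sigma {..<n} I"
    have fin: "finite (I i)" if "i < n" for i using F[OF that] by (simp add: interval_family_def)
    have "(\<Sum>p\<in>?J. \<bar>f (case_prod R p) - f (case_prod L p)\<bar>) < e/2"
    proof (rule D)
      show "interval_family a b ?J (case_prod L) (case_prod R)"
        unfolding interval_family_def
      proof (intro conjI ballI)
        show "finite ?J" using fin by auto
        fix p assume "p \<in> ?J"
        then obtain i j where p: "p = (i, j)" "i < n" "j \<in> I i" by auto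
        show "a \<le> case_prod L p" "case_prod L p \<le> case_prod R p" "case_prod R p \<le> b"
          using interval_familyD[OF F[OF p(2)] p(3)] lr[rule_format, OF p(2)] p(1) by auto
      next
        show "disjoint_family_on (\<lambda>p. {case_prod L p<..<case_prod R p}) ?J"
          unfolding disjoint_family_on_def
        proof (intro ballI impI)
          fix p q assume pq: "p \<in> ?J" "q \<in> ?J" "p \<noteq> q"
          obtain i j i' j' where e: "p = (i,j)" "q = (i',j')" by (cases p, cases q)
          have mem: "i < n" "j \<in> I i" "i' < n" "j' \<in> I i'" using pq e by auto
          show "{case_prod L p<..<case_prod R p} \<inter> {case_prod L q<..<case_prod R q} = {}"
          proof (cases "i = i'")
            case True
            then show ?thesis
              using F[OF mem(1)] mem pq(3) e unfolding interval_family_def disjoint_family_on_def by auto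
          next
            case False
            have "{L i j<..<R i j} \<subseteq> {l i<..<r i}" "{L i' j'<..<R i' j'} \<subseteq> {l i'<..<r i'}"
              using interval_familyD[OF F[OF mem(1)] mem(2)] interval_familyD[OF F[OF mem(3)] mem(4)] by auto
            moreover have "{l i<..<r i} \<inter> {l i'<..<r i'} = {}"
              using dis False mem by blast
            ultimately show ?thesis unfolding e case_prod_conv by blast
          qed
        qed
      qed
      have "(\<Sum>p\<in>?J. case_prod R p - case_prod L p) = (\<Sum>i<n. \<Sum>j\<in>I i. R i j - L i j)"
        using fin by (subst sum.Sigma) (auto simp: split_def)
      also have "\<dots> \<le> (\<Sum>i<n. r i - l i)"
        using F lr by (intro sum_mono interval_family_length) auto
      finally show "(\<Sum>p\<in>?J. case_prod R p - case_prod L p) < d" using len by simp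
    qed
    moreover have "(\<Sum>p\<in>?J. \<bar>f (case_prod R p) - f (case_prod L p)\<bar>) = (\<Sum>i<n. \<Sum>j\<in>I i. \<bar>f (R i j) - f (L i j)\<bar>)"
      using fin by (subst sum.Sigma) (auto simp: split_def)
    moreover have "(\<Sum>i<n. \<bar>pos_var f a (r i) - pos_var f a (l i)\<bar>)
        \<le> (\<Sum>i<n. (\<Sum>j\<in>I i. \<bar>f (R i j) - f (L i j)\<bar>) + \<eta>)"
    proof (rule sum_mono)
      fix i assume "i \<in> {..<n}"
      then have i: "i < n" by simp
      have "(\<Sum>j\<in>I i. f (R i j) - f (L i j)) \<le> (\<Sum>j\<in>I i. \<bar>f (R i j) - f (L i j)\<bar>)"
        by (intro sum_mono) auto
      then show "\<bar>pos_var f a (r i) - pos_var f a (l i)\<bar> \<le> (\<Sum>j\<in>I i. \<bar>f (R i j) - f (L i j)\<bar>) + \<eta>"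
        using S[OF i] pos_var_mono[OF assms, of "l i" "r i"] lr i by fastforce
    qed
    moreover have "(\<Sum>i<n. \<eta>) = e/2" using n by (simp add: \<eta>_def)
    ultimately show ?thesis by (simp add: sum.distrib)
  qed
  with d show "\<exists>d>0. \<forall>(n::nat) l r. (\<forall>i<n. a \<le> l i \<and> l i \<le> r i \<and> r i \<le> b) \<longrightarrow>
             (\<forall>i<n. \<forall>j<n. i \<noteq> j \<longrightarrow> {l i<..<r i} \<inter> {l j<..<r j} = {}) \<longrightarrow>
             (\<Sum>i<n. r i - l i) < d \<longrightarrow> (\<Sum>i<n. \<bar>pos_var f a (r i) - pos_var f a (l i)\<bar>) < e"
    by blast
qed

lemma abs_cont_on_diff:
  assumes "abs_cont_on a b f" "abs_cont_on a b g"
  shows "abs_cont_on a b (\<lambda>x. f x - g x)"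
  unfolding abs_cont_on_def
proof (intro allI impI)
  fix e :: real assume "e > 0"
  then have "e/2 > 0" by simp
  obtain d1 where d1: "d1 > 0" "\<And>(n::nat) l r. (\<forall>i<n. a \<le> l i \<and> l i \<le> r i \<and> r i \<le> b) \<Longrightarrow>
        (\<forall>i<n. \<forall>j<n. i \<noteq> j \<longrightarrow> {l i<..<r i} \<inter> {l j<..<r j} = {}) \<Longrightarrow>
        (\<Sum>i<n. r i - l i) < d1 \<Longrightarrow> (\<Sum>i<n. \<bar>f (r i) - f (l i)\<bar>) < e/2"
    using assms(1) \<open>e/2 > 0\<close> unfolding abs_cont_on_def by blast
  obtain d2 where d2: "d2 > 0" "\<And>(n::nat) l r. (\<forall>i<n. a \<le> l i \<and> l i \<le> r i \<and> r i \<le> b) \<Longrightarrow>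
        (\<forall>i<n. \<forall>j<n. i \<noteq> j \<longrightarrow> {l i<..<r i} \<inter> {l j<..<r j} = {}) \<Longrightarrow>
        (\<Sum>i<n. r i - l i) < d2 \<Longrightarrow> (\<Sum>i<n. \<bar>g (r i) - g (l i)\<bar>) < e/2"
    using assms(2) \<open>e/2 > 0\<close> unfolding abs_cont_on_def by blast
  show "\<exists>d>0. \<forall>(n::nat) l r. (\<forall>i<n. a \<le> l i \<and> l i \<le> r i \<and> r i \<le> b) \<longrightarrow>
             (\<forall>i<n. \<forall>j<n. i \<noteq> j \<longrightarrow> {l i<..<r i} \<inter> {l j<..<r j} = {}) \<longrightarrow>
             (\<Sum>i<n. r i - l i) < d \<longrightarrow> (\<Sum>i<n. \<bar>f (r i) - g (r i) - (f (l i) - g (l i))\<bar>) < e"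
  proof (intro exI[of _ "min d1 d2"] conjI allI impI)
    fix n :: nat and l r
    assume A: "\<forall>i<n. a \<le> l i \<and> l i \<le> r i \<and> r i \<le> b"
      "\<forall>i<n. \<forall>j<n. i \<noteq> j \<longrightarrow> {l i<..<r i} \<inter> {l j<..<r j} = {}"
      "(\<Sum>i<n. r i - l i) < min d1 d2"
    have "(\<Sum>i<n. \<bar>f (r i) - g (r i) - (f (l i) - g (l i))\<bar>)
        \<le> (\<Sum>i<n. \<bar>f (r i) - f (l i)\<bar> + \<bar>g (r i) - g (l i)\<bar>)"
      by (intro sum_mono) linarith
    then show "(\<Sum>i<n. \<bar>f (r i) - g (r i) - (f (l i) - g (l i))\<bar>) < e"
      using d1(2)[OF A(1,2)] d2(2)[OF A(1,2)] A(3) by (simp add: sum.distrib)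
  qed (use d1 d2 in auto)
qed

section \<open>The fundamental theorem of calculus for absolutely continuous functions\<close>

lemma open_connected_bounded_eq_Ioo:
  fixes C :: "real set"
  assumes "open C" "connected C" "bounded C" "C \<noteq> {}"
  shows "C = {Inf C<..<Sup C}"
proof (intro subset_antisym subsetI)
  have bd: "bdd_below C" "bdd_above C"
    using assms(3) by (auto intro: bounded_imp_bdd_below bounded_imp_bdd_above)
  fix x
  {
    assume "x \<in> C"
    then obtain e where e: "e > 0" "cball x e \<subseteq> C"
      using assms(1) open_contains_cball by blast
    then have "x - e \<in> C" "x + e \<in> C"
      by (auto simp: subset_iff dist_real_def)
    then have "Inf C \<le> x - e" "x + e \<le> Sup C"
      using bd by (auto intro: cInf_lower cSup_upper)
    then show "x \<in> {Inf C<..<Sup C}" using e by auto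
  next
    assume "x \<in> {Inf C<..<Sup C}"
    then obtain y z where "y \<in> C" "y < x" "z \<in> C" "x < z"
      using cInf_lessD[OF assms(4), of x] less_cSupD[OF assms(4), of x] by auto
    then show "x \<in> C"
      using assms(2) unfolding connected_iff_interval by (meson less_imp_le)
  }
qed

lemma abs_cont_on_imp_continuous_on:
  assumes "abs_cont_on a b f"
  shows "continuous_on {a..b} f"
  unfolding continuous_on_iff
proof (intro ballI allI impI)
  fix x e :: real assume x: "x \<in> {a..b}" and e: "e > 0"
  obtain d where d: "d > 0" and D: "\<And>(I::nat set) l r. interval_family a b I l r \<Longrightarrow>
      (\<Sum>i\<in>I. r i - l i) < d \<Longrightarrow> (\<Sum>i\<in>I. \<bar>f (r i) - f (l i)\<bar>) < e"
    using abs_cont_on_family[OF assms e, where 'i = nat] by metis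
  have "dist (f y) (f x) < e" if y: "y \<in> {a..b}" "dist y x < d" for y
    using D[of "{0}" "\<lambda>_. min x y" "\<lambda>_. max x y"] x y
    by (auto simp: interval_family_def disjoint_family_on_def dist_real_def min_def max_def
        abs_if split: if_splits)
  with d show "\<exists>d>0. \<forall>x'\<in>{a..b}. dist x' x < d \<longrightarrow> dist (f x') (f x) < e" by blast
qed

text \<open>Composition with the clamp extends a function on \<open>{a..b}\<close> by constants to
  the whole line, where \<open>interval_measure\<close> lives. The fifth property puts the interval
  between clamped endpoints inside the original one, so that clamping keeps a family disjoint; the
  third keeps it short.\<close>

lemma clamp_real:
  fixes a b :: real
  assumes "a \<le> b" and c: "c = (\<lambda>x. max a (min b x))"
  shows "c x \<in> {a..b}" "x \<le> y \<Longrightarrow> c x \<le> c y" "x \<le> y \<Longrightarrow> c y - c x \<le> y - x"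
    "x \<in> {a..b} \<Longrightarrow> c x = x" "x < z \<Longrightarrow> c x < u \<Longrightarrow> u < c z \<Longrightarrow> x < u \<and> u < z" "continuous_on UNIV c"
proof -
  show "continuous_on UNIV c" unfolding c by (intro continuous_intros)
qed (use assms(1) in \<open>auto simp: c min_def max_def split: if_splits\<close>)

text \<open>The outer approximation of a null set by an open set is decomposed into its components, which
  form a family as in the definition of absolute continuity.\<close>

lemma absolutely_continuous_interval_measure:
  fixes a b :: real and F :: "real \<Rightarrow> real"
  assumes ab: "a \<le> b" and ac: "abs_cont_on a b F" and mono: "mono_on {a..b} F"
  defines "G \<equiv> \<lambda>x. F (max a (min b x))"
  shows "absolutely_continuous lborel (interval_measure G)"
proof -
  let ?\<mu> = "interval_measure G"
  define c where "c = (\<lambda>x. max a (min b x))"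
  note c = clamp_real[OF ab c_def]
  have Gc: "G = (\<lambda>x. F (c x))" by (simp add: G_def c_def)
  have G_mono: "G x \<le> G y" if "x \<le> y" for x y
    unfolding Gc by (rule mono_onD[OF mono c(1) c(1) c(2)[OF that]])
  have "continuous_on UNIV (F \<circ> c)"
    by (intro continuous_on_compose c(6) continuous_on_subset[OF abs_cont_on_imp_continuous_on[OF ac]])
      (use c(1) in auto)
  then have G_cont: "continuous_on UNIV G" by (simp add: Gc comp_def)
  \<comment> \<open>For bounded \<open>B\<close> the open cover can be taken bounded, so each of its
    components has the form \<open>{Inf C<..<Sup C}\<close>. A general null set is the countable
    union of its bounded parts.\<close>
  have bounded_null: "B \<in> null_sets ?\<mu>" if B: "B \<in> null_sets lborel" "B \<subseteq> {- real m<..<real m}" for B m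
  proof -
    have "emeasure ?\<mu> B \<le> ennreal e" if e: "e > 0" for e
    proof -
      obtain d where d: "d > 0" and D: "\<And>(I::real set set) l r. interval_family a b I l r \<Longrightarrow>
          (\<Sum>i\<in>I. r i - l i) < d \<Longrightarrow> (\<Sum>i\<in>I. \<bar>F (r i) - F (l i)\<bar>) < e"
        using abs_cont_on_family[OF ac e, where 'i = "real set"] by metis
      have B': "B \<in> sets borel" "emeasure lborel B = 0" using B(1) by (auto simp: null_sets_def)
      obtain U where U: "open U" "B \<subseteq> U" "emeasure lborel (U - B) < d"
        using outer_regular_lborel[OF B'(1) d] by blast
      have "emeasure lborel U \<le> emeasure lborel (U - B) + emeasure lborel B"
        using U B' by (intro order_trans[OF _ emeasure_subadditive] emeasure_mono) auto
      then have Ud: "emeasure lborel U < d" using U(3) B'(2) by simp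
      define V where "V = U \<inter> {- real m<..<real m}"
      have V: "open V" "B \<subseteq> V" "emeasure lborel V < d"
        using U B(2) Ud le_less_trans[OF emeasure_mono[of V U lborel] Ud] by (auto simp: V_def)
      define \<C> where "\<C> = components V"
      have comp: "open C" "C = {Inf C<..<Sup C}" "Inf C < Sup C" if "C \<in> \<C>" for C
      proof -
        show "open C" using that V(1) open_components by (auto simp: \<C>_def)
        have "C \<subseteq> V" using that in_components_subset by (auto simp: \<C>_def)
        then have "bounded C"
          by (rule bounded_subset[rotated]) (auto simp: V_def intro: bounded_subset[of "{- real m<..<real m}"])
        moreover have "connected C" "C \<noteq> {}"
          using that in_components_connected in_components_nonempty by (auto simp: \<C>_def)
        ultimately show *: "C = {Inf C<..<Sup C}"
          using open_connected_bounded_eq_Ioo \<open>open C\<close> by blast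
        show "Inf C < Sup C"
        proof (rule ccontr)
          assume "\<not> Inf C < Sup C"
          then have "{Inf C<..<Sup C} = {}" by simp
          with * \<open>C \<noteq> {}\<close> show False by simp
        qed
      qed
      have disj: "C \<inter> C' = {}" if "C \<in> \<C>" "C' \<in> \<C>" "C \<noteq> C'" for C C'
        using that pairwise_disjoint_components[of V] by (auto simp: pairwise_def \<C>_def)
      \<comment> \<open>Absolute continuity speaks of finitely many intervals only. The bound is
        uniform in the finite subfamily, so continuity of the measure from below extends it to all
        of \<open>V\<close>.\<close>
      have fin: "emeasure ?\<mu> (\<Union>\<D>) \<le> ennreal e" if \<D>: "finite \<D>" "\<D> \<subseteq> \<C>" for \<D>
      proof -
        have le: "Inf C \<le> Sup C" if "C \<in> \<D>" for C
          using comp(3)[of C] that \<D>(2) by (intro less_imp_le) auto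
        have fam: "interval_family a b \<D> (\<lambda>C. c (Inf C)) (\<lambda>C. c (Sup C))"
          unfolding interval_family_def disjoint_family_on_def
        proof (intro conjI ballI impI)
          fix C C' assume CC: "C \<in> \<D>" "C' \<in> \<D>" "C \<noteq> C'"
          have "{c (Inf C)<..<c (Sup C)} \<subseteq> C" if "C \<in> \<C>" for C
            using c(5)[OF comp(3)[OF that]] by (subst (3) comp(2)[OF that]) auto
          moreover have "C \<in> \<C>" "C' \<in> \<C>" using CC \<D> by auto
          ultimately show "{c (Inf C)<..<c (Sup C)} \<inter> {c (Inf C')<..<c (Sup C')} = {}"
            using disj[of C C'] CC(3) by blast
        qed (use \<D> c(1) c(2)[OF le] in auto)
        have "(\<Sum>C\<in>\<D>. c (Sup C) - c (Inf C)) \<le> (\<Sum>C\<in>\<D>. Sup C - Inf C)"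
          using le by (intro sum_mono c(3)) auto
        also have "\<dots> = (\<Sum>C\<in>\<D>. measure lborel C)"
        proof (rule sum.cong)
          fix C assume C: "C \<in> \<D>"
          then have "measure lborel C = measure lborel {Inf C<..<Sup C}"
            using comp(2)[of C] \<D>(2) by auto
          then show "Sup C - Inf C = measure lborel C" using le[OF C] by simp
        qed simp
        finally have len1: "(\<Sum>C\<in>\<D>. c (Sup C) - c (Inf C)) \<le> (\<Sum>C\<in>\<D>. measure lborel C)" .
        have lt: "emeasure lborel C < top" if "C \<in> \<D>" for C
        proof -
          have "C \<subseteq> V" using that \<D>(2) in_components_subset by (auto simp: \<C>_def)
          then have "emeasure lborel C \<le> emeasure lborel V" using V(1) by (intro emeasure_mono) auto
          then show ?thesis using V(3) by (simp add: le_less_trans less_trans[OF _ ennreal_less_top])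
        qed
        have "ennreal (\<Sum>C\<in>\<D>. measure lborel C) = (\<Sum>C\<in>\<D>. emeasure lborel C)"
          using lt by (subst sum_ennreal[symmetric]) (auto intro!: sum.cong simp: emeasure_eq_ennreal_measure less_top)
        also have "\<dots> = emeasure lborel (\<Union>\<D>)"
        proof -
          have "(\<lambda>C. C) ` \<D> \<subseteq> sets lborel" using \<D>(2) comp(1) by fastforce
          moreover have "disjoint_family_on (\<lambda>C. C) \<D>"
            using \<D>(2) disj unfolding disjoint_family_on_def by blast
          ultimately show ?thesis using sum_emeasure[of "\<lambda>C. C" \<D> lborel] \<D>(1) by simp
        qed
        also have "\<dots> \<le> emeasure lborel V"
        proof (rule emeasure_mono)
          show "\<Union>\<D> \<subseteq> V" using \<D>(2) Union_components[of V] unfolding \<C>_def by blast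
        qed (use V(1) in simp)
        also have "\<dots> < ennreal d" by (rule V(3))
        finally have "(\<Sum>C\<in>\<D>. measure lborel C) < d"
          using d by (simp add: ennreal_less_iff sum_nonneg)
        then have De: "(\<Sum>C\<in>\<D>. \<bar>F (c (Sup C)) - F (c (Inf C))\<bar>) < e"
          using D[OF fam] len1 by linarith
        have "emeasure ?\<mu> (\<Union>\<D>) \<le> (\<Sum>C\<in>\<D>. emeasure ?\<mu> C)"
        proof -
          have "(\<lambda>C. C) ` \<D> \<subseteq> sets ?\<mu>" using \<D>(2) comp(1) by fastforce
          then show ?thesis using emeasure_subadditive_finite[of \<D> "\<lambda>C. C" ?\<mu>] \<D>(1) by simp
        qed
        also have "\<dots> \<le> (\<Sum>C\<in>\<D>. ennreal (G (Sup C) - G (Inf C)))"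
        proof (rule sum_mono)
          fix C assume C: "C \<in> \<D>"
          have "C \<in> \<C>" using \<D>(2) C by auto
          then have "x \<in> {Inf C..Sup C}" if "x \<in> C" for x
            using equalityD1[OF comp(2), THEN subsetD, OF _ that] by simp
          then have "C \<subseteq> {Inf C..Sup C}" by blast
          then have "emeasure ?\<mu> C \<le> emeasure ?\<mu> {Inf C..Sup C}" by (intro emeasure_mono) auto
          also have "\<dots> = ennreal (G (Sup C) - G (Inf C))"
            by (rule emeasure_interval_measure_Icc[OF le[OF C] G_mono G_cont])
          finally show "emeasure ?\<mu> C \<le> ennreal (G (Sup C) - G (Inf C))" .
        qed
        also have "\<dots> = ennreal (\<Sum>C\<in>\<D>. G (Sup C) - G (Inf C))"
          using G_mono le by (intro sum_ennreal) auto
        also have "\<dots> \<le> ennreal e"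
        proof (rule ennreal_leI)
          have "(\<Sum>C\<in>\<D>. G (Sup C) - G (Inf C)) \<le> (\<Sum>C\<in>\<D>. \<bar>F (c (Sup C)) - F (c (Inf C))\<bar>)"
            unfolding Gc by (intro sum_mono) auto
          then show "(\<Sum>C\<in>\<D>. G (Sup C) - G (Inf C)) \<le> e" using De by simp
        qed
        finally show ?thesis .
      qed
      show ?thesis
      proof (cases "\<C> = {}")
        case True
        then have "V = {}" unfolding \<C>_def by simp
        then show ?thesis using V(2) by simp
      next
        case False
        have cnt: "countable \<C>"
        proof (rule countable_disjoint_open_subsets)
          show "pairwise disjnt \<C>" unfolding pairwise_def disjnt_def using disj by blast
        qed (rule comp(1))
        define A where "A n = \<Union>(from_nat_into \<C> ` {..n})" for n :: nat
        have AC: "from_nat_into \<C> n \<in> \<C>" for n using from_nat_into[OF False] .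
        have "(\<Union>n. A n) = \<Union>(range (from_nat_into \<C>))" unfolding A_def by blast
        then have "V = (\<Union>n. A n)"
          using range_from_nat_into[OF False cnt] Union_components[of V] by (simp add: \<C>_def)
        moreover have "(SUP n. emeasure ?\<mu> (A n)) = emeasure ?\<mu> (\<Union>n. A n)"
        proof (rule SUP_emeasure_incseq)
          have "open (A n)" for n unfolding A_def by (intro open_Union ballI) (use comp(1)[OF AC] in blast)
          then show "range A \<subseteq> sets ?\<mu>" by auto
          show "incseq A" unfolding A_def by (intro incseq_SucI Union_mono image_mono) auto
        qed
        moreover have "(SUP n. emeasure ?\<mu> (A n)) \<le> ennreal e"
          unfolding A_def using AC by (intro SUP_least fin) auto
        ultimately have "emeasure ?\<mu> V \<le> ennreal e" by simp
        then show ?thesis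
          using V emeasure_mono[of B V ?\<mu>] by (simp add: order_trans)
      qed
    qed
    then have "emeasure ?\<mu> B \<le> 0 + ennreal e" if "e > 0" for e
      using that by simp
    then have "emeasure ?\<mu> B \<le> 0"
      by (intro ennreal_le_epsilon[of 0]) blast
    then show ?thesis using B(1) by (auto simp: null_sets_def)
  qed
  show ?thesis
    unfolding absolutely_continuous_def
  proof
    fix N assume N: "N \<in> null_sets (lborel :: real measure)"
    have "N \<inter> {- real m<..<real m} \<in> null_sets ?\<mu>" for m
      by (rule bounded_null) (use N in \<open>auto intro: null_set_Int2\<close>)
    then have "(\<Union>m. N \<inter> {- real m<..<real m}) \<in> null_sets ?\<mu>" by blast
    moreover have "(\<Union>m. N \<inter> {- real m<..<real m}) = N"
    proof -
      have "\<exists>m. - real m < x \<and> x < real m" for x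
        using reals_Archimedean2[of "\<bar>x\<bar>"] by (auto simp: abs_less_iff minus_less_iff)
      then show ?thesis by auto
    qed
    ultimately show "N \<in> null_sets ?\<mu>" by simp
  qed
qed

lemma mono_abs_cont_on_density:
  fixes a b :: real and F :: "real \<Rightarrow> real"
  assumes ab: "a \<le> b" and ac: "abs_cont_on a b F" and mono: "mono_on {a..b} F"
  obtains g where "integrable lborel g" "\<And>x. x \<in> {a..b} \<Longrightarrow> F x - F a = integral {a..x} g"
proof -
  define c where "c = (\<lambda>x. max a (min b x))"
  note c = clamp_real[OF ab c_def]
  define G where "G = (\<lambda>x. F (max a (min b x)))"
  have Gc: "G = (\<lambda>x. F (c x))" by (simp add: G_def c_def)
  have G_mono: "G x \<le> G y" if "x \<le> y" for x y
    unfolding Gc by (rule mono_onD[OF mono c(1) c(1) c(2)[OF that]])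
  have "continuous_on UNIV (F \<circ> c)"
    by (intro continuous_on_compose c(6) continuous_on_subset[OF abs_cont_on_imp_continuous_on[OF ac]])
      (use c(1) in auto)
  then have G_cont: "continuous_on UNIV G" by (simp add: Gc comp_def)
  let ?\<mu> = "interval_measure G"
  have "\<exists>k\<in>borel_measurable lborel. density lborel k = ?\<mu>"
    unfolding G_def
    by (rule sigma_finite_measure.Radon_Nikodym[OF sigma_finite_lborel
          absolutely_continuous_interval_measure[OF ab ac mono]]) simp
  then obtain k where k[measurable]: "k \<in> borel_measurable lborel" and dens: "density lborel k = ?\<mu>"
    by blast
  have nn: "(\<integral>\<^sup>+y. k y * indicator {a..x} y \<partial>lborel) = ennreal (F x - F a)" if x: "x \<in> {a..b}" for x
  proof -
    have "(\<integral>\<^sup>+y. k y * indicator {a..x} y \<partial>lborel) = emeasure ?\<mu> {a..x}"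
      unfolding dens[symmetric] by (subst emeasure_density) auto
    also have "\<dots> = ennreal (G x - G a)"
      using x by (intro emeasure_interval_measure_Icc G_mono G_cont) auto
    also have "G x - G a = F x - F a"
      unfolding Gc using x ab c(4)[of x] c(4)[of a] by simp
    finally show ?thesis .
  qed
  \<comment> \<open>The Radon-Nikodym density has values in \<open>ennreal\<close>. Its integral
    over \<open>{a..b}\<close> is finite, so it is finite almost everywhere there, and
    \<open>enn2real\<close> changes it only on a null set.\<close>
  define g where "g = (\<lambda>y. enn2real (k y * indicator {a..b} y))"
  have [measurable]: "g \<in> borel_measurable lborel" unfolding g_def by measurable
  have "AE y in lborel. k y * indicator {a..b} y \<noteq> \<infinity>"
    using nn[of b] ab by (intro nn_integral_PInf_AE) auto
  then have g: "AE y in lborel. ennreal (g y) = k y * indicator {a..b} y"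
    by eventually_elim (simp add: g_def less_top)
  have int: "has_bochner_integral lborel (\<lambda>y. indicator {a..x} y *\<^sub>R g y) (F x - F a)" if x: "x \<in> {a..b}" for x
  proof (rule has_bochner_integral_nn_integral)
    show "AE y in lborel. 0 \<le> indicator {a..x} y *\<^sub>R g y" by (simp add: g_def)
    have "a \<le> x" using x by simp
    then show "0 \<le> F x - F a" using mono_onD[OF mono, of a x] x ab by simp
    have "(\<integral>\<^sup>+y. ennreal (indicator {a..x} y *\<^sub>R g y) \<partial>lborel) = (\<integral>\<^sup>+y. k y * indicator {a..x} y \<partial>lborel)"
    proof (rule nn_integral_cong_AE)
      show "AE y in lborel. ennreal (indicator {a..x} y *\<^sub>R g y) = k y * indicator {a..x} y"
        using g by eventually_elim (use x in \<open>auto simp: indicator_def split: if_splits\<close>)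
    qed
    then show "(\<integral>\<^sup>+y. ennreal (indicator {a..x} y *\<^sub>R g y) \<partial>lborel) = ennreal (F x - F a)"
      using nn[OF x] by simp
  qed measurable
  show thesis
  proof
    have "(\<lambda>y. indicator {a..b} y *\<^sub>R g y) = g" by (auto simp: g_def indicator_def)
    then show "integrable lborel g" using int[of b] ab by (auto simp: has_bochner_integral_iff)
    fix x assume x: "x \<in> {a..b}"
    have "set_integrable lborel {a..x} g"
      using int[OF x] by (simp add: set_integrable_def has_bochner_integral_iff)
    then have "integral {a..x} g = (LINT y:{a..x}|lborel. g y)"
      by (simp add: set_borel_integral_eq_integral)
    also have "\<dots> = F x - F a"
      using int[OF x] by (simp add: set_lebesgue_integral_def has_bochner_integral_iff)
    finally show "F x - F a = integral {a..x} g" by simp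
  qed
qed

lemma integrable_lborel_imp_integrable_on:
  fixes g :: "real \<Rightarrow> real"
  assumes "integrable lborel g"
  shows "g integrable_on {x..y}"
proof -
  have "set_integrable lborel {x..y} g"
    unfolding set_integrable_def using assms by (intro integrable_mult_indicator) auto
  then show ?thesis by (rule set_borel_integral_eq_integral)
qed

lemma abs_cont_on_density:
  fixes a b :: real and f :: "real \<Rightarrow> real"
  assumes ab: "a \<le> b" and ac: "abs_cont_on a b f"
  obtains g where "integrable lborel g" "\<And>x. x \<in> {a..b} \<Longrightarrow> f x - f a = integral {a..x} g"
proof -
  define P where "P = pos_var f a"
  define Q where "Q = (\<lambda>x. P x - f x)"
  have "abs_cont_on a b P" unfolding P_def by (rule abs_cont_on_pos_var[OF ac])
  moreover have "mono_on {a..b} P"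
    unfolding P_def by (rule mono_onI) (use pos_var_mono[OF ac] in auto)
  ultimately obtain p where p: "integrable lborel p" "\<And>x. x \<in> {a..b} \<Longrightarrow> P x - P a = integral {a..x} p"
    using mono_abs_cont_on_density[OF ab] by metis
  have "abs_cont_on a b Q"
    unfolding Q_def by (rule abs_cont_on_diff[OF \<open>abs_cont_on a b P\<close> ac])
  moreover have "mono_on {a..b} Q"
  proof (rule mono_onI)
    fix x y assume "x \<in> {a..b}" "y \<in> {a..b}" "x \<le> y"
    then show "Q x \<le> Q y"
      using pos_var_diff_ge[OF ac, of x y] by (auto simp: Q_def P_def)
  qed
  ultimately obtain q where q: "integrable lborel q" "\<And>x. x \<in> {a..b} \<Longrightarrow> Q x - Q a = integral {a..x} q"
    using mono_abs_cont_on_density[OF ab] by metis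
  show thesis
  proof (rule that)
    show "integrable lborel (\<lambda>x. p x - q x)" using p q by simp
    fix x assume x: "x \<in> {a..b}"
    have "integral {a..x} (\<lambda>x. p x - q x) = (P x - P a) - (Q x - Q a)"
      using p q x by (simp add: integral_diff integrable_lborel_imp_integrable_on)
    then show "f x - f a = integral {a..x} (\<lambda>x. p x - q x)" by (simp add: Q_def)
  qed
qed

section \<open>Lebesgue differentiation on the line\<close>

lemma negligible_uminus_image:
  fixes N :: "real set"
  assumes "negligible N"
  shows "negligible (uminus ` N)"
  by (rule negligible_differentiable_image_negligible)
    (use assms in \<open>auto intro!: derivative_intros simp: differentiable_on_def\<close>)

lemma AE_right_average_tendsto:
  fixes g :: "real \<Rightarrow> real"
  assumes "\<And>x y. g integrable_on {x..y}"
  obtains N where "negligible N"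
    "\<And>x e. x \<notin> N \<Longrightarrow> 0 < e \<Longrightarrow> \<exists>d>0. \<forall>h. 0 < h \<and> h < d \<longrightarrow> \<bar>integral {x..x+h} g / h - g x\<bar> < e"
proof -
  obtain N where N: "negligible N" and *: "\<And>x e. \<lbrakk>x \<notin> N; 0 < e\<rbrakk> \<Longrightarrow>
      \<exists>d>0. \<forall>h. 0 < h \<and> h < d \<longrightarrow>
         norm (integral (cbox x (x + h *\<^sub>R One)) g /\<^sub>R h ^ DIM(real) - g x) < e"
    using integrable_ccontinuous_explicit[of g] assms by (metis box_real(2))
  show thesis
  proof (rule that[OF N])
    fix x e :: real assume "x \<notin> N" "0 < e"
    from *[OF this] show "\<exists>d>0. \<forall>h. 0 < h \<and> h < d \<longrightarrow> \<bar>integral {x..x+h} g / h - g x\<bar> < e"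
      by (simp add: divide_inverse mult.commute)
  qed
qed

text \<open>Averages over \<open>{x..x+h}\<close> control the right difference quotients. The left
  ones are right averages of the reflected function at \<open>- x\<close>, hence the reflected
  exceptional set. The set \<open>N\<close> is chosen before the lower limit
  \<open>a\<close>.\<close>

lemma AE_has_real_derivative_integral:
  fixes g :: "real \<Rightarrow> real"
  assumes g: "\<And>x y. g integrable_on {x..y}"
  obtains N where "negligible N"
    "\<And>a x. x \<notin> N \<Longrightarrow> a < x \<Longrightarrow> ((\<lambda>t. integral {a..t} g) has_real_derivative g x) (at x)"
proof -
  obtain N1 where N1: "negligible N1"
    "\<And>x e. x \<notin> N1 \<Longrightarrow> 0 < e \<Longrightarrow> \<exists>d>0. \<forall>h. 0 < h \<and> h < d \<longrightarrow> \<bar>integral {x..x+h} g / h - g x\<bar> < e"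
    using AE_right_average_tendsto[OF g] by metis
  have g': "(\<lambda>x. g (- x)) integrable_on {x..y}" for x y
    using Henstock_Kurzweil_Integration.integrable_reflect_real[where f = g and a = "- y" and b = "- x"] g by simp
  obtain N2 where N2: "negligible N2"
    "\<And>x e. x \<notin> N2 \<Longrightarrow> 0 < e \<Longrightarrow> \<exists>d>0. \<forall>h. 0 < h \<and> h < d \<longrightarrow>
        \<bar>integral {x..x+h} (\<lambda>x. g (- x)) / h - g (- x)\<bar> < e"
    using AE_right_average_tendsto[OF g'] by metis
  show thesis
  proof (rule that[of "N1 \<union> uminus ` N2"])
    show "negligible (N1 \<union> uminus ` N2)"
      using N1(1) N2(1) negligible_uminus_image by (simp add: negligible_Un)
    fix a x :: real assume x: "x \<notin> N1 \<union> uminus ` N2" "a < x"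
    let ?F = "\<lambda>t. integral {a..t} g"
    have "- x \<notin> N2" using x(1) by force
    show "(?F has_real_derivative g x) (at x)"
      unfolding DERIV_def
    proof (rule LIM_I)
      fix e :: real assume e: "0 < e"
      obtain d1 where d1: "d1 > 0" "\<And>h. 0 < h \<Longrightarrow> h < d1 \<Longrightarrow> \<bar>integral {x..x+h} g / h - g x\<bar> < e"
        using N1(2)[of x e] x e by auto
      obtain d2 where d2: "d2 > 0" "\<And>h. 0 < h \<Longrightarrow> h < d2 \<Longrightarrow>
          \<bar>integral {- x..- x+h} (\<lambda>x. g (- x)) / h - g x\<bar> < e"
        using N2(2)[OF \<open>- x \<notin> N2\<close> e] by auto
      \<comment> \<open>The bound \<open>x - a\<close> keeps \<open>x + h\<close> to the right of
        the lower limit, so that the integral can be split there when \<open>h < 0\<close>.\<close>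
      define d where "d = min (min d1 d2) (x - a)"
      have "norm ((?F (x + h) - ?F x) / h - g x) < e" if h: "h \<noteq> 0" "norm (h - 0) < d" for h
      proof (cases "h > 0")
        case True
        have "?F (x + h) = ?F x + integral {x..x+h} g"
          using x(2) True by (intro Henstock_Kurzweil_Integration.integral_combine[symmetric] g) auto
        then show ?thesis using d1(2)[of h] True h by (simp add: d_def)
      next
        case False
        then have neg: "h < 0" "x + h > a" "- h < d2" using h by (auto simp: d_def)
        have "?F x = ?F (x + h) + integral {x+h..x} g"
          using neg by (intro Henstock_Kurzweil_Integration.integral_combine[symmetric] g) auto
        moreover have "integral {- x..- x+(- h)} (\<lambda>x. g (- x)) = integral {x+h..x} g"
          using Henstock_Kurzweil_Integration.integral_reflect_real[where f = g and a = "x + h" and b = x] by (simp add: algebra_simps)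
        ultimately have "(?F (x + h) - ?F x) / h = integral {- x..- x+(- h)} (\<lambda>x. g (- x)) / (- h)"
          by (simp add: field_simps)
        then show ?thesis using d2(2)[of "- h"] neg by simp
      qed
      moreover have "d > 0" using d1 d2 x by (simp add: d_def)
      ultimately show "\<exists>s>0. \<forall>h. h \<noteq> 0 \<and> norm (h - 0) < s \<longrightarrow> norm ((?F (x + h) - ?F x) / h - g x) < e"
        by blast
    qed
  qed
qed

text \<open>A density \<open>g\<close> is known only through its integrals; differentiating them
  identifies it with \<open>deriv f\<close> off a null set. The endpoints join that set because the
  two-sided \<open>deriv f\<close> there depends on values outside \<open>{a..b}\<close>.\<close>

lemma abs_cont_on_FTC:
  fixes a b :: real and f :: "real \<Rightarrow> real"
  assumes ab: "a \<le> b" and ac: "abs_cont_on a b f"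
  shows "integrable (lebesgue_on {a..b}) (deriv f)"
    and "\<And>x. x \<in> {a..b} \<Longrightarrow> (deriv f has_integral (f x - f a)) {a..x}"
proof -
  obtain g where g: "integrable lborel g" "\<And>x. x \<in> {a..b} \<Longrightarrow> f x - f a = integral {a..x} g"
    using abs_cont_on_density[OF ab ac] by metis
  have gi: "g integrable_on {x..y}" for x y by (rule integrable_lborel_imp_integrable_on[OF g(1)])
  obtain N where N: "negligible N"
    "\<And>a x. x \<notin> N \<Longrightarrow> a < x \<Longrightarrow> ((\<lambda>t. integral {a..t} g) has_real_derivative g x) (at x)"
    using AE_has_real_derivative_integral[OF gi] by metis
  have deriv: "deriv f x = g x" if x: "x \<in> {a<..<b}" "x \<notin> N" for x
  proof (rule DERIV_imp_deriv)
    have "((\<lambda>t. f a + integral {a..t} g) has_real_derivative g x) (at x)"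
      using N(2)[of x a] x by (auto intro!: derivative_eq_intros)
    then show "(f has_real_derivative g x) (at x)"
    proof (rule has_field_derivative_transform_within_open[where S = "{a<..<b}"])
      show "f a + integral {a..t} g = f t" if "t \<in> {a<..<b}" for t
        using g(2)[of t] that by auto
    qed (use x in auto)
  qed
  have N': "negligible (N \<union> {a, b})" using N(1) by (simp add: negligible_Un)
  have "set_integrable lborel {a..b} g"
    unfolding set_integrable_def using g(1) by (intro integrable_mult_indicator) auto
  then have "g absolutely_integrable_on {a..b}"
    unfolding set_integrable_def by (rule integrable_completion[THEN iffD2, rotated]) 
      (use g(1) in auto)
  then have "deriv f absolutely_integrable_on {a..b}"
    by (rule absolutely_integrable_spike[OF _ N']) (use deriv in auto)
  then show "integrable (lebesgue_on {a..b}) (deriv f)"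
    by (rule absolutely_integrable_imp_integrable) simp
  fix x assume x: "x \<in> {a..b}"
  have "(g has_integral (f x - f a)) {a..x}"
    using g(2)[OF x] gi[of a x] by (simp add: integrable_integral)
  from has_integral_spike[OF N' _ this] show "(deriv f has_integral (f x - f a)) {a..x}"
    using x deriv by auto
qed

section \<open>Integration by parts through Fubini's theorem\<close>

lemma integral_lebesgue_on_subset:
  fixes f :: "real \<Rightarrow> real"
  assumes "S \<subseteq> T" "S \<in> sets lebesgue" "T \<in> sets lebesgue"
  shows "(LINT x|lebesgue_on T. indicator S x * f x) = (LINT x|lebesgue_on S. f x)"
proof -
  have "(LINT x|lebesgue_on T. indicator S x * f x) = (LINT x|lebesgue. indicator T x *\<^sub>R (indicator S x * f x))"
    by (rule integral_restrict_space) (use assms in auto)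
  also have "\<dots> = (LINT x|lebesgue. indicator S x *\<^sub>R f x)"
    by (rule Bochner_Integration.integral_cong) (use assms in \<open>auto simp: indicator_def\<close>)
  also have "\<dots> = (LINT x|lebesgue_on S. f x)"
    by (rule integral_restrict_space[symmetric]) (use assms in auto)
  finally show ?thesis .
qed

text \<open>Both sides are the integral of \<open>f s * k t\<close> over the triangle
  \<open>s \<le> t\<close>, computed in the two orders. Integrability of the factors is enough, as
  the product is integrable on the square and dominates its restriction to the triangle.\<close>

lemma integral_by_parts_indefinite:
  fixes f k :: "real \<Rightarrow> real"
  assumes f: "integrable (lebesgue_on {a..b}) f" and k: "integrable (lebesgue_on {a..b}) k"
  shows "(LINT t|lebesgue_on {a..b}. k t * integral {a..t} f)
       = (LINT s|lebesgue_on {a..b}. f s * integral {s..b} k)"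
proof -
  let ?L = "lebesgue_on {a..b}"
  interpret L: finite_measure ?L by (rule finite_measure_lebesgue_on) simp
  interpret P: pair_sigma_finite ?L ?L ..
  have [measurable]: "f \<in> borel_measurable ?L" "k \<in> borel_measurable ?L" using f k by auto
  have fk: "integrable (?L \<Otimes>\<^sub>M ?L) (\<lambda>(s, t). f s * k t)"
  proof (rule P.Fubini_integrable)
    show "(\<lambda>(s, t). f s * k t) \<in> borel_measurable (?L \<Otimes>\<^sub>M ?L)" by measurable
    show "integrable ?L (\<lambda>s. LINT t|?L. norm (case (s, t) of (s, t) \<Rightarrow> f s * k t))"
      using f by (simp add: abs_mult)
    show "AE s in ?L. integrable ?L (\<lambda>t. case (s, t) of (s, t) \<Rightarrow> f s * k t)"
      using k by simp
  qed
  \<comment> \<open>Composed with the two projections, this makes the triangle measurable in the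
    product of the Lebesgue spaces.\<close>
  have meas_id: "(\<lambda>x. x) \<in> borel_measurable ?L"
    by (rule measurable_restrict_space1) (simp add: measurable_completion)
  define q where "q = (\<lambda>s t. if s \<le> t then f s * k t else 0)"
  have "integrable (?L \<Otimes>\<^sub>M ?L) (\<lambda>(s, t). q s t)"
  proof (rule Bochner_Integration.integrable_bound[OF fk])
    have "(\<lambda>p. fst p) \<in> borel_measurable (?L \<Otimes>\<^sub>M ?L)" "(\<lambda>p. snd p) \<in> borel_measurable (?L \<Otimes>\<^sub>M ?L)"
      by (rule measurable_compose[OF measurable_fst meas_id], rule measurable_compose[OF measurable_snd meas_id])
    then have "{p \<in> space (?L \<Otimes>\<^sub>M ?L). fst p \<le> snd p} \<in> sets (?L \<Otimes>\<^sub>M ?L)"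
      by (rule borel_measurable_le)
    moreover have "(\<lambda>p. f (fst p) * k (snd p)) \<in> borel_measurable (?L \<Otimes>\<^sub>M ?L)" by measurable
    ultimately show "(\<lambda>(s, t). q s t) \<in> borel_measurable (?L \<Otimes>\<^sub>M ?L)"
      unfolding q_def split_def by (intro measurable_If) simp_all
    show "AE p in ?L \<Otimes>\<^sub>M ?L. norm (case p of (s, t) \<Rightarrow> q s t) \<le>
        norm (case p of (s, t) \<Rightarrow> f s * k t)"
      by (auto simp: q_def)
  qed
  then have "(LINT t|?L. LINT s|?L. q s t) = (LINT s|?L. LINT t|?L. q s t)"
    by (rule P.Fubini_integral)
  moreover have "(LINT s|?L. q s t) = k t * integral {a..t} f" if t: "t \<in> {a..b}" for t
  proof -
    have fi: "integrable (lebesgue_on {a..t}) f" by (rule integrable_subinterval[OF f]) (use t in auto)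
    have "(LINT s|?L. q s t) = (LINT s|?L. k t * (indicator {a..t} s * f s))"
      by (rule Bochner_Integration.integral_cong) (use t in \<open>auto simp: q_def indicator_def\<close>)
    also have "\<dots> = k t * (LINT s|?L. indicator {a..t} s * f s)" by simp
    also have "(LINT s|?L. indicator {a..t} s * f s) = (LINT s|lebesgue_on {a..t}. f s)"
      using t by (intro integral_lebesgue_on_subset) auto
    also have "\<dots> = integral {a..t} f" by (rule lebesgue_integral_eq_integral[OF fi]) simp
    finally show ?thesis .
  qed
  then have "(LINT t|?L. LINT s|?L. q s t) = (LINT t|?L. k t * integral {a..t} f)"
    by (intro Bochner_Integration.integral_cong) simp_all
  moreover have "(LINT t|?L. q s t) = f s * integral {s..b} k" if s: "s \<in> {a..b}" for s
  proof -
    have ki: "integrable (lebesgue_on {s..b}) k" by (rule integrable_subinterval[OF k]) (use s in auto)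
    have "(LINT t|?L. q s t) = (LINT t|?L. f s * (indicator {s..b} t * k t))"
      by (rule Bochner_Integration.integral_cong) (use s in \<open>auto simp: q_def indicator_def\<close>)
    also have "\<dots> = f s * (LINT t|?L. indicator {s..b} t * k t)" by simp
    also have "(LINT t|?L. indicator {s..b} t * k t) = (LINT t|lebesgue_on {s..b}. k t)"
      using s by (intro integral_lebesgue_on_subset) auto
    also have "\<dots> = integral {s..b} k" by (rule lebesgue_integral_eq_integral[OF ki]) simp
    finally show ?thesis .
  qed
  then have "(LINT s|?L. LINT t|?L. q s t) = (LINT s|?L. f s * integral {s..b} k)"
    by (intro Bochner_Integration.integral_cong) simp_all
  ultimately show ?thesis by simp
qed

section \<open>Weak solutions\<close>

lemma AE_lebesgue_on_notin:
  assumes "negligible N"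
  shows "AE x in lebesgue_on {a..b::real}. x \<notin> N"
proof -
  have "AE x in lebesgue. x \<notin> N"
    unfolding eventually_ae_filter_negligible using assms by auto
  then show ?thesis by (subst AE_restrict_space_iff) auto
qed

lemma L2_on_imp_integrable:
  assumes "f \<in> L2_on a b"
  shows "integrable (lebesgue_on {a..b}) f"
proof (rule Bochner_Integration.integrable_bound)
  interpret finite_measure "lebesgue_on {a..b}" by (rule finite_measure_lebesgue_on) simp
  show "integrable (lebesgue_on {a..b}) (\<lambda>x. 1 + (f x)\<^sup>2)"
    using assms by (simp add: L2_on_def)
  have "\<bar>y\<bar> \<le> 1 + y\<^sup>2" for y :: real
    using zero_le_power2[of "\<bar>y\<bar> - 1"] by (simp add: power2_diff)
  then show "AE x in lebesgue_on {a..b}. norm (f x) \<le> norm (1 + (f x)\<^sup>2)"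
    by (simp add: abs_of_nonneg)
qed (use assms in \<open>simp add: L2_on_def\<close>)

lemma L2_on_mult_integrable:
  assumes "f \<in> L2_on a b" "g \<in> L2_on a b"
  shows "integrable (lebesgue_on {a..b}) (\<lambda>x. f x * g x)"
proof (rule Bochner_Integration.integrable_bound)
  show "integrable (lebesgue_on {a..b}) (\<lambda>x. (f x)\<^sup>2 + (g x)\<^sup>2)"
    using assms by (simp add: L2_on_def)
  have "\<bar>y * z\<bar> \<le> y\<^sup>2 + z\<^sup>2" for y z :: real
    using zero_le_power2[of "\<bar>y\<bar> - \<bar>z\<bar>"] zero_le_power2[of "y"] zero_le_power2[of "z"]
    unfolding power2_diff abs_mult power2_abs by linarith
  then show "AE x in lebesgue_on {a..b}. norm (f x * g x) \<le> norm ((f x)\<^sup>2 + (g x)\<^sup>2)"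
    by simp
qed (use assms in \<open>auto simp: L2_on_def\<close>)

lemma L2_on_bounded:
  assumes "f \<in> borel_measurable (lebesgue_on {a..b})" "\<And>x. x \<in> {a..b} \<Longrightarrow> \<bar>f x\<bar> \<le> C"
  shows "f \<in> L2_on a b"
proof -
  interpret finite_measure "lebesgue_on {a..b}" by (rule finite_measure_lebesgue_on) simp
  have "\<bar>(f x)\<^sup>2\<bar> \<le> C\<^sup>2" if "x \<in> {a..b}" for x
    using power_mono[OF assms(2)[OF that], of 2] by simp
  then have "integrable (lebesgue_on {a..b}) (\<lambda>x. (f x)\<^sup>2)"
    using assms(1) by (intro integrable_const_bound[of _ "C\<^sup>2"] AE_I2) auto
  with assms(1) show ?thesis by (simp add: L2_on_def)
qed

lemma continuous_on_Icc_bounded: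
  fixes f :: "real \<Rightarrow> real"
  assumes "continuous_on {a..b} f"
  obtains C where "\<And>x. x \<in> {a..b} \<Longrightarrow> \<bar>f x\<bar> \<le> C"
  using compact_imp_bounded[OF compact_continuous_image[OF assms compact_Icc]]
  unfolding bounded_iff by (metis imageI real_norm_def)

lemma continuous_on_imp_L2_on:
  assumes "continuous_on {a..b} f"
  shows "f \<in> L2_on a b"
proof -
  obtain C where "\<And>x. x \<in> {a..b} \<Longrightarrow> \<bar>f x\<bar> \<le> C"
    using continuous_on_Icc_bounded[OF assms] by blast
  moreover have "f \<in> borel_measurable (lebesgue_on {a..b})"
    using assms by (intro continuous_imp_measurable_on_sets_lebesgue) auto
  ultimately show ?thesis by (rule L2_on_bounded[rotated])
qed

lemma L2_on_mult_continuous: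
  assumes "f \<in> L2_on a b" "continuous_on {a..b} g"
  shows "(\<lambda>x. f x * g x) \<in> L2_on a b"
proof -
  obtain C where C: "\<And>x. x \<in> {a..b} \<Longrightarrow> \<bar>g x\<bar> \<le> C"
    using continuous_on_Icc_bounded[OF assms(2)] by blast
  have [measurable]: "f \<in> borel_measurable (lebesgue_on {a..b})" "g \<in> borel_measurable (lebesgue_on {a..b})"
    using assms(1) continuous_on_imp_L2_on[OF assms(2)] by (auto simp: L2_on_def)
  have le: "norm ((f x * g x)\<^sup>2) \<le> norm (C\<^sup>2 * (f x)\<^sup>2)" if "x \<in> {a..b}" for x
    using mult_left_mono[OF power_mono[OF C[OF that], of 2], of "(f x)\<^sup>2"]
    by (simp add: power_mult_distrib mult.commute)
  have "integrable (lebesgue_on {a..b}) (\<lambda>x. (f x * g x)\<^sup>2)"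
  proof (rule Bochner_Integration.integrable_bound)
    show "integrable (lebesgue_on {a..b}) (\<lambda>x. C\<^sup>2 * (f x)\<^sup>2)" using assms(1) by (simp add: L2_on_def)
    show "AE x in lebesgue_on {a..b}. norm ((f x * g x)\<^sup>2) \<le> norm (C\<^sup>2 * (f x)\<^sup>2)"
      using le by (intro AE_I2) simp
  qed measurable
  then show ?thesis by (simp add: L2_on_def)
qed

lemma integrable_lebesgue_on_spike:
  fixes f g :: "real \<Rightarrow> real"
  assumes "integrable (lebesgue_on {a..b}) f" "negligible N" "\<And>x. x \<in> {a..b} - N \<Longrightarrow> g x = f x"
  shows "integrable (lebesgue_on {a..b}) g"
proof (rule absolutely_integrable_imp_integrable)
  have "f absolutely_integrable_on {a..b}" using assms(1) by (simp add: set_integrable_eq)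
  then show "g absolutely_integrable_on {a..b}"
    by (rule absolutely_integrable_spike[OF _ assms(2,3)])
qed simp

lemma L2_on_spike:
  assumes "f \<in> L2_on a b" "negligible N" "\<And>x. x \<in> {a..b} - N \<Longrightarrow> g x = f x"
  shows "g \<in> L2_on a b"
proof -
  have "integrable (lebesgue_on {a..b}) g"
    by (rule integrable_lebesgue_on_spike[OF L2_on_imp_integrable[OF assms(1)] assms(2,3)])
  moreover have "integrable (lebesgue_on {a..b}) (\<lambda>x. (g x)\<^sup>2)"
    by (rule integrable_lebesgue_on_spike[of _ _ "\<lambda>x. (f x)\<^sup>2" N]) (use assms in \<open>auto simp: L2_on_def\<close>)
  ultimately show ?thesis by (simp add: L2_on_def)
qed

section \<open>Piecewise linear test functions\<close>

lemma lipschitz_imp_abs_cont_on: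
  assumes lip: "\<And>x y. x \<in> {a..b} \<Longrightarrow> y \<in> {a..b} \<Longrightarrow> \<bar>f x - f y\<bar> \<le> C * \<bar>x - y\<bar>"
  shows "abs_cont_on a b f"
  unfolding abs_cont_on_def
proof (intro allI impI)
  fix e :: real assume e: "e > 0"
  define d where "d = e / (\<bar>C\<bar> + 1)"
  have d: "d > 0" "(\<bar>C\<bar> + 1) * d = e" using e by (auto simp: d_def)
  have "(\<Sum>i<n. \<bar>f (r i) - f (l i)\<bar>) < e"
    if lr: "\<forall>i<n. a \<le> l i \<and> l i \<le> r i \<and> r i \<le> b" and len: "(\<Sum>i<n. r i - l i) < d" for n :: nat and l r
  proof -
    have "(\<Sum>i<n. \<bar>f (r i) - f (l i)\<bar>) \<le> (\<Sum>i<n. (\<bar>C\<bar> + 1) * (r i - l i))"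
    proof (rule sum_mono)
      fix i assume "i \<in> {..<n}"
      then have i: "a \<le> l i" "l i \<le> r i" "r i \<le> b" using lr by auto
      have "\<bar>f (r i) - f (l i)\<bar> \<le> C * \<bar>r i - l i\<bar>" using i by (intro lip) auto
      also have "\<dots> \<le> (\<bar>C\<bar> + 1) * (r i - l i)" using i by (intro mult_mono) auto
      finally show "\<bar>f (r i) - f (l i)\<bar> \<le> (\<bar>C\<bar> + 1) * (r i - l i)" .
    qed
    also have "\<dots> = (\<bar>C\<bar> + 1) * (\<Sum>i<n. r i - l i)" by (simp add: sum_distrib_left)
    also have "\<dots> < (\<bar>C\<bar> + 1) * d" using len by (intro mult_strict_left_mono) auto
    finally show ?thesis using d by simp
  qed
  with d show "\<exists>d>0. \<forall>(n::nat) l r. (\<forall>i<n. a \<le> l i \<and> l i \<le> r i \<and> r i \<le> b) \<longrightarrow>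
             (\<forall>i<n. \<forall>j<n. i \<noteq> j \<longrightarrow> {l i<..<r i} \<inter> {l j<..<r j} = {}) \<longrightarrow>
             (\<Sum>i<n. r i - l i) < d \<longrightarrow> (\<Sum>i<n. \<bar>f (r i) - f (l i)\<bar>) < e"
    by blast
qed

text \<open>The antiderivative of the indicator of \<open>{a..q}\<close> minus its mean over
  \<open>{a..b}\<close>; subtracting the mean restores the zero at \<open>b\<close>. For
  \<open>q\<close> in \<open>{a..b}\<close> this is the Green function of minus the second
  derivative with Dirichlet conditions and pole \<open>q\<close>.\<close>

definition hat :: "real \<Rightarrow> real \<Rightarrow> real \<Rightarrow> real \<Rightarrow> real" where
  "hat a b q t = min t q - a - (q - a) / (b - a) * (t - a)"

lemma deriv_hat:
  assumes "t \<noteq> q"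
  shows "deriv (hat a b q) t = (if t < q then 1 else 0) - (q - a) / (b - a)"
proof -
  define c where "c = (q - a) / (b - a)"
  have hat: "hat a b q = (\<lambda>t. min t q - a - c * (t - a))" by (simp add: fun_eq_iff hat_def c_def)
  show ?thesis
  proof (cases "t < q")
    case True
    have "((\<lambda>t. t - a - c * (t - a)) has_real_derivative 1 - c) (at t)"
      by (auto intro!: derivative_eq_intros)
    then have "(hat a b q has_real_derivative 1 - c) (at t)"
      by (rule has_field_derivative_transform_within_open[where S = "{..<q}"])
        (use True in \<open>auto simp: hat\<close>)
    with True show ?thesis by (simp add: DERIV_imp_deriv flip: c_def)
  next
    case False
    have "((\<lambda>t. q - a - c * (t - a)) has_real_derivative - c) (at t)"
      by (auto intro!: derivative_eq_intros)
    then have "(hat a b q has_real_derivative - c) (at t)"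
      by (rule has_field_derivative_transform_within_open[where S = "{q<..}"])
        (use False assms in \<open>auto simp: hat\<close>)
    with False show ?thesis by (simp add: DERIV_imp_deriv flip: c_def)
  qed
qed

lemma hat_in_H1:
  assumes "a < b" "q \<in> {a..b}"
  shows "hat a b q \<in> H1 a b"
proof -
  define c where "c = (q - a) / (b - a)"
  have "\<bar>hat a b q x - hat a b q y\<bar> \<le> (1 + \<bar>c\<bar>) * \<bar>x - y\<bar>" for x y
  proof -
    have "hat a b q x - hat a b q y = (min x q - min y q) - c * (x - y)"
      unfolding hat_def c_def[symmetric] by (simp add: algebra_simps)
    also have "\<bar>\<dots>\<bar> \<le> \<bar>min x q - min y q\<bar> + \<bar>c * (x - y)\<bar>" by (rule abs_triangle_ineq4)
    also have "\<bar>min x q - min y q\<bar> \<le> \<bar>x - y\<bar>" by (auto simp: min_def)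
    finally show ?thesis by (simp add: abs_mult distrib_right)
  qed
  then have "abs_cont_on a b (hat a b q)" by (rule lipschitz_imp_abs_cont_on)
  moreover have "hat a b q \<in> L2_on a b"
    unfolding hat_def[abs_def] by (intro continuous_on_imp_L2_on continuous_intros)
  moreover have "deriv (hat a b q) \<in> L2_on a b"
  proof (rule L2_on_spike[where N = "{q}"])
    show "(\<lambda>t. (if t < q then 1 else 0) - c) \<in> L2_on a b"
    proof (rule L2_on_bounded)
      have "(\<lambda>t. (if t < q then 1 else 0) - c) \<in> borel_measurable borel" by measurable
      then show "(\<lambda>t. (if t < q then 1 else 0) - c) \<in> borel_measurable (lebesgue_on {a..b})"
        by (intro measurable_restrict_space1 measurable_completion) simp
      show "\<bar>(if t < q then 1 else 0) - c\<bar> \<le> 1 + \<bar>c\<bar>" for t by auto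
    qed
  qed (auto simp: deriv_hat c_def)
  ultimately show ?thesis using assms by (auto simp: H1_def hat_def)
qed

lemma continuous_zero_on_Rats:
  fixes D :: "real \<Rightarrow> real"
  assumes "a < b" "continuous_on {a..b} D" "\<And>q. q \<in> \<rat> \<inter> {a..b} \<Longrightarrow> D q = 0" "t \<in> {a..b}"
  shows "D t = 0"
proof (rule ccontr)
  assume "D t \<noteq> 0"
  then obtain d where d: "d > 0" "\<And>x. x \<in> {a..b} \<Longrightarrow> dist x t < d \<Longrightarrow> dist (D x) (D t) < \<bar>D t\<bar>"
    using assms(2,4) unfolding continuous_on_iff by (metis zero_less_abs_iff)
  have "max a (t - d) < min b (t + d)" using assms d(1) by auto
  then obtain q where "q \<in> \<rat>" "max a (t - d) < q" "q < min b (t + d)"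
    using Rats_dense_in_real by blast
  moreover from this have "dist q t < d" by (simp add: dist_real_def abs_less_iff)
  ultimately show False using d(2)[of q] assms(3)[of q] by (simp add: dist_real_def)
qed

text \<open>Testing against the hat functions identifies \<open>u' - u w\<close> with a constant; the antiderivative
  is determined by its values at the rational points, so countably many test functions suffice.\<close>

lemma weak_solution_imp_ode:
  assumes ab: "a < b" and w: "continuous_on {a..b} w" and u: "u \<in> form_dom a b"
    and weak: "\<And>q. q \<in> \<rat> \<inter> {a..b} \<Longrightarrow> weak_form a b w u (hat a b q) = 0"
  obtains c where
    "\<And>t. t \<in> {a..b} \<Longrightarrow> (u has_real_derivative (u t * w t + c)) (at t within {a..b})"
proof -
  have ac: "abs_cont_on a b u" and L2: "deriv u \<in> L2_on a b" using u by (auto simp: form_dom_def)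
  have cu: "continuous_on {a..b} u" by (rule abs_cont_on_imp_continuous_on[OF ac])
  have cuw: "continuous_on {a..b} (\<lambda>t. u t * w t)" by (intro continuous_intros cu w)
  let ?L = "lebesgue_on {a..b}"
  have iuw: "integrable ?L (\<lambda>t. u t * w t)"
    by (rule L2_on_imp_integrable[OF continuous_on_imp_L2_on[OF cuw]])
  \<comment> \<open>The weak form of \<open>u\<close> tested with \<open>h\<close> is the integral
    of \<open>g\<close> times \<open>deriv h\<close>.\<close>
  define g where "g = (\<lambda>t. u t * w t - deriv u t)"
  have ig: "integrable ?L g" unfolding g_def using iuw L2_on_imp_integrable[OF L2] by simp
  have int_g: "integral {a..q} g = integral {a..q} (\<lambda>t. u t * w t) - (u q - u a)" if "q \<in> {a..b}" for q
  proof -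
    have "((\<lambda>t. u t * w t) has_integral integral {a..q} (\<lambda>t. u t * w t)) {a..q}"
      using that by (intro integrable_integral integrable_continuous_real continuous_on_subset[OF cuw]) auto
    from has_integral_diff[OF this abs_cont_on_FTC(2)[OF less_imp_le[OF ab] ac that]]
    show ?thesis unfolding g_def by (rule integral_unique)
  qed
  \<comment> \<open>The derivative of the hat is an indicator minus a constant, so a vanishing test
    says that the antiderivative of \<open>g\<close> is linear in \<open>q\<close>.\<close>
  have key: "integral {a..q} g = (q - a) / (b - a) * integral {a..b} g" if q: "q \<in> \<rat> \<inter> {a..b}" for q
  proof -
    let ?k = "deriv (hat a b q)"
    have q': "q \<in> {a..b}" using q by auto
    have k: "?k \<in> L2_on a b" using hat_in_H1[OF ab q'] by (simp add: H1_def)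
    have i1: "integrable ?L (\<lambda>t. deriv u t * ?k t)" by (rule L2_on_mult_integrable[OF L2 k])
    have i2: "integrable ?L (\<lambda>t. u t * ?k t * w t)"
      using L2_on_mult_integrable[OF continuous_on_imp_L2_on[OF cuw] k] by (simp add: mult_ac)
    have ind: "integrable ?L (\<lambda>t. indicator {a..q} t * g t)"
      using integrable_mult_indicator[OF _ ig, of "{a..q}"] q' by (simp add: sets_restrict_space_iff)
    have "0 = (LINT t|?L. u t * ?k t * w t - deriv u t * ?k t)"
      using weak[OF q] i1 i2 by (simp add: weak_form_def)
    also have "\<dots> = (LINT t|?L. indicator {a..q} t * g t - (q - a) / (b - a) * g t)"
    proof (rule integral_cong_AE)
      show "(\<lambda>t. u t * ?k t * w t - deriv u t * ?k t) \<in> borel_measurable ?L"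
        by (rule borel_measurable_integrable[OF Bochner_Integration.integrable_diff[OF i2 i1]])
      show "(\<lambda>t. indicator {a..q} t * g t - (q - a) / (b - a) * g t) \<in> borel_measurable ?L"
        by (rule borel_measurable_integrable[OF Bochner_Integration.integrable_diff[OF ind integrable_mult_right[OF ig]]])
      show "AE t in ?L. u t * ?k t * w t - deriv u t * ?k t = indicator {a..q} t * g t - (q - a) / (b - a) * g t"
        using AE_lebesgue_on_notin[of "{q}" a b] AE_space
      proof (rule eventually_elim2)
        fix t assume "t \<notin> {q}" "t \<in> space ?L"
        then have "?k t = indicator {a..q} t - (q - a) / (b - a)"
          using deriv_hat[of t q a b] by (auto simp: indicator_def)
        moreover have "u t * ?k t * w t - deriv u t * ?k t = ?k t * g t"
          by (simp add: g_def right_diff_distrib mult_ac)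
        ultimately show "u t * ?k t * w t - deriv u t * ?k t = indicator {a..q} t * g t - (q - a) / (b - a) * g t"
          by (simp only: left_diff_distrib)
      qed simp
    qed
    also have "\<dots> = (LINT t|?L. indicator {a..q} t * g t) - (q - a) / (b - a) * (LINT t|?L. g t)"
      using ind ig by simp
    also have "(LINT t|?L. indicator {a..q} t * g t) = (LINT t|lebesgue_on {a..q}. g t)"
      using q' by (intro integral_lebesgue_on_subset) auto
    also have "\<dots> = integral {a..q} g"
      by (rule lebesgue_integral_eq_integral) (use q' in \<open>auto intro: integrable_subinterval[OF ig]\<close>)
    also have "(LINT t|?L. g t) = integral {a..b} g"
      by (rule lebesgue_integral_eq_integral[OF ig]) simp
    finally show ?thesis by simp
  qed
  \<comment> \<open>The negative of the mean value of \<open>g\<close>; the minus sign comes from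
    \<open>g\<close> being \<open>u w - u'\<close>.\<close>
  define c where "c = - integral {a..b} g / (b - a)"
  define I where "I = (\<lambda>t. integral {a..t} (\<lambda>s. u s * w s))"
  have dI: "(I has_real_derivative u t * w t) (at t within {a..b})" if "t \<in> {a..b}" for t
    unfolding I_def by (rule integral_has_real_derivative[OF cuw that])
  have rep: "u t = u a + I t + c * (t - a)" if t: "t \<in> {a..b}" for t
  proof -
    have "u t - (u a + I t + c * (t - a)) = 0"
    proof (rule continuous_zero_on_Rats[OF ab _ _ t])
      have "continuous_on {a..b} I" by (rule DERIV_continuous_on) (rule dI)
      then show "continuous_on {a..b} (\<lambda>t. u t - (u a + I t + c * (t - a)))"
        by (intro continuous_intros cu)
      fix q assume q: "q \<in> \<rat> \<inter> {a..b}"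
      have "c * (q - a) = - ((q - a) / (b - a) * integral {a..b} g)" by (simp add: c_def)
      moreover have "I q - (u q - u a) = (q - a) / (b - a) * integral {a..b} g"
        using key[OF q] int_g[of q] q unfolding I_def by (metis IntD2)
      ultimately show "u q - (u a + I q + c * (q - a)) = 0" by linarith
    qed
    then show ?thesis by simp
  qed
  show thesis
  proof (rule that)
    fix t assume t: "t \<in> {a..b}"
    have "((\<lambda>t. u a + I t + c * (t - a)) has_real_derivative u t * w t + c) (at t within {a..b})"
      using dI[OF t] by (auto intro!: derivative_eq_intros)
    \<comment> \<open>The two functions agree on all of \<open>{a..b}\<close>, so any positive
      radius would do.\<close>
    then show "(u has_real_derivative (u t * w t + c)) (at t within {a..b})"
      by (rule has_field_derivative_transform_within[where d = 1]) (use t in \<open>auto simp: rep[symmetric]\<close>)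
  qed
qed

text \<open>With the integrating factor \<open>exp (- J)\<close>, where \<open>J\<close> is an
  antiderivative of \<open>w\<close>, the product has derivative zero and is constant. A zero thus
  propagates in both directions.\<close>

lemma linear_ode_zero:
  fixes y w :: "real \<Rightarrow> real"
  assumes w: "continuous_on {a..b} w"
    and y: "\<And>t. t \<in> {a..b} \<Longrightarrow> (y has_real_derivative (y t * w t)) (at t within {a..b})"
    and st: "s \<in> {a..b}" "t \<in> {a..b}" "y s = 0"
  shows "y t = 0"
proof -
  define J where "J = (\<lambda>t. integral {a..t} w)"
  have J: "(J has_real_derivative w t) (at t within {a..b})" if "t \<in> {a..b}" for t
    unfolding J_def by (rule integral_has_real_derivative[OF w that])
  have "((\<lambda>t. y t * exp (- J t)) has_field_derivative 0) (at t within {a..b})" if "t \<in> {a..b}" for t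
    using DERIV_mult[OF y[OF that] DERIV_chain2[OF DERIV_exp DERIV_minus[OF J[OF that]]]]
    by (simp add: algebra_simps)
  then have "\<exists>C. \<forall>t\<in>{a..b}. y t * exp (- J t) = C"
    by (intro has_field_derivative_zero_constant) auto
  then obtain C where C: "\<And>t. t \<in> {a..b} \<Longrightarrow> y t * exp (- J t) = C"
    by blast
  show ?thesis using C[OF st(1)] C[OF st(2)] st(3) by simp
qed

lemma has_real_derivative_Icc_imp_deriv:
  fixes F :: "real \<Rightarrow> real"
  assumes "(F has_real_derivative D) (at t within {a..b})" "t \<in> {a<..<b}"
  shows "deriv F t = D"
  using assms by (intro DERIV_imp_deriv) (simp add: at_within_Icc_at)

text \<open>Integration by parts with one factor \<open>y\<close> continuously differentiable and
  the other the antiderivative of a merely integrable \<open>p\<close>, to which the pointwise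
  product rule need not apply everywhere.\<close>

lemma integral_deriv_times_indefinite:
  fixes y y' p :: "real \<Rightarrow> real"
  assumes y: "\<And>t. t \<in> {a..b} \<Longrightarrow> (y has_real_derivative y' t) (at t within {a..b})"
    and y': "continuous_on {a..b} y'" and p: "integrable (lebesgue_on {a..b}) p"
  shows "integral {a..b} (\<lambda>t. y' t * integral {a..t} p) = y b * integral {a..b} p - integral {a..b} (\<lambda>t. y t * p t)"
proof -
  let ?L = "lebesgue_on {a..b}"
  have ip: "p integrable_on {a..b}" using p by (intro integrable_on_lebesgue_on) auto
  have cy: "continuous_on {a..b} y" by (rule DERIV_continuous_on) (rule y)
  have cP: "continuous_on {a..b} (\<lambda>t. integral {a..t} p)"
    by (rule indefinite_integral_continuous_1[OF ip])
  have i1: "integrable ?L (\<lambda>t. y' t * integral {a..t} p)"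
    by (rule L2_on_imp_integrable, rule continuous_on_imp_L2_on) (intro continuous_intros y' cP)
  have i2: "integrable ?L (\<lambda>t. y t * p t)"
  proof -
    obtain C where C: "\<And>x. x \<in> {a..b} \<Longrightarrow> \<bar>y x\<bar> \<le> C"
      using continuous_on_Icc_bounded[OF cy] by blast
    show ?thesis
    proof (rule Bochner_Integration.integrable_bound)
      show "integrable ?L (\<lambda>t. C * p t)" using p by simp
      show "AE t in ?L. norm (y t * p t) \<le> norm (C * p t)"
      proof (rule AE_I2)
        fix t assume "t \<in> space ?L"
        then have "\<bar>y t\<bar> \<le> \<bar>C\<bar>" using C[of t] by simp
        then show "norm (y t * p t) \<le> norm (C * p t)" by (simp add: abs_mult mult_right_mono)
      qed
      have "y \<in> borel_measurable ?L" using continuous_on_imp_L2_on[OF cy] by (simp add: L2_on_def)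
      then show "(\<lambda>t. y t * p t) \<in> borel_measurable ?L" using p by auto
    qed
  qed
  have "integral {a..b} (\<lambda>t. y' t * integral {a..t} p) = (LINT t|?L. y' t * integral {a..t} p)"
    by (rule lebesgue_integral_eq_integral[symmetric, OF i1]) simp
  also have "\<dots> = (LINT s|?L. p s * integral {s..b} y')"
    by (rule integral_by_parts_indefinite[OF p L2_on_imp_integrable[OF continuous_on_imp_L2_on[OF y']]])
  also have "\<dots> = (LINT s|?L. y b * p s - y s * p s)"
  proof (rule Bochner_Integration.integral_cong)
    fix s assume "s \<in> space ?L"
    then have s: "s \<in> {a..b}" by simp
    have "(y' has_integral (y b - y s)) {s..b}"
    proof (rule fundamental_theorem_of_calculus)
      fix t assume "t \<in> {s..b}"
      then have "t \<in> {a..b}" "{s..b} \<subseteq> {a..b}" using s by auto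
      then show "(y has_vector_derivative y' t) (at t within {s..b})"
        using has_field_derivative_subset[OF y]
        unfolding has_real_derivative_iff_has_vector_derivative by blast
    next
      show "s \<le> b" using s by simp
    qed
    then show "p s * integral {s..b} y' = y b * p s - y s * p s"
      by (simp add: integral_unique algebra_simps)
  qed simp
  also have "\<dots> = y b * (LINT s|?L. p s) - (LINT s|?L. y s * p s)"
    using p i2 by simp
  also have "(LINT s|?L. p s) = integral {a..b} p" by (rule lebesgue_integral_eq_integral[OF p]) simp
  also have "(LINT s|?L. y s * p s) = integral {a..b} (\<lambda>t. y t * p t)"
    by (rule lebesgue_integral_eq_integral[OF i2]) simp
  finally show ?thesis .
qed

section \<open>The Green operator of a single path\<close>

text \<open>One outcome is frozen: \<open>w\<close> is a path of the Brownian motion, and the two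
  solutions enter through their first order equations instead of the weak form.\<close>

locale green_path =
  fixes a b c d :: real and w u v f :: "real \<Rightarrow> real"
  assumes ab: "a < b" and w: "continuous_on {a..b} w"
    and u_ode: "\<And>t. t \<in> {a..b} \<Longrightarrow> (u has_real_derivative (u t * w t + c)) (at t within {a..b})"
    and v_ode: "\<And>t. t \<in> {a..b} \<Longrightarrow> (v has_real_derivative (v t * w t + d)) (at t within {a..b})"
    and bc: "u a = 0" "u b = 1" "v a = 1" "v b = 0"
    and f: "f \<in> L2_on a b"
begin

text \<open>The Wronskian \<open>u' v - v' u\<close> after inserting the equations, in which the
  terms with \<open>w\<close> cancel. Unlike \<open>green_alpha\<close> it does not involve
  \<open>deriv\<close> and is controlled at the endpoints as well.\<close>

definition \<alpha> :: "real \<Rightarrow> real" where "\<alpha> t = c * v t - d * u t"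
definition p :: "real \<Rightarrow> real" where "p s = v s * f s / \<alpha> s"
definition r :: "real \<Rightarrow> real" where "r s = u s * f s / \<alpha> s"
definition A :: "real \<Rightarrow> real" where "A t = integral {a..t} p"
definition B :: "real \<Rightarrow> real" where "B t = integral {t..b} r"
text \<open>The expression \<open>u' A + v' B\<close> with the equations inserted, which makes its
  continuity up to the endpoints visible.\<close>

definition \<psi> :: "real \<Rightarrow> real" where "\<psi> t = (u t * w t + c) * A t + (v t * w t + d) * B t"

lemma cont_u: "continuous_on {a..b} u" by (rule DERIV_continuous_on) (rule u_ode)
lemma cont_v: "continuous_on {a..b} v" by (rule DERIV_continuous_on) (rule v_ode)

text \<open>For \<open>c = 0\<close> the equation of \<open>u\<close> is homogeneous, and the zero
  at \<open>a\<close> would force the value 0 at \<open>b\<close>.\<close>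

lemma c_nonzero: "c \<noteq> 0"
proof
  assume "c = 0"
  then have "u b = 0"
    using linear_ode_zero[OF w, of u a b] u_ode ab bc(1) by simp
  with bc(2) show False by simp
qed

text \<open>The constant terms cancel and \<open>\<alpha>\<close> solves the homogeneous equation,
  so a zero anywhere would spread to \<open>a\<close>, where the boundary values give
  \<open>\<alpha> a = c\<close>.\<close>

lemma \<alpha>_nonzero: assumes "t \<in> {a..b}" shows "\<alpha> t \<noteq> 0"
proof
  assume "\<alpha> t = 0"
  moreover have "(\<alpha> has_real_derivative (\<alpha> t * w t)) (at t within {a..b})" if "t \<in> {a..b}" for t
    unfolding \<alpha>_def using u_ode[OF that] v_ode[OF that]
    by (auto intro!: derivative_eq_intros simp: algebra_simps)
  ultimately have "\<alpha> a = 0" using linear_ode_zero[OF w, of \<alpha> t a] assms ab by auto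
  then show False using c_nonzero bc by (simp add: \<alpha>_def)
qed

lemma green_alpha_eq: assumes "t \<in> {a<..<b}" shows "green_alpha u v t = \<alpha> t"
  using has_real_derivative_Icc_imp_deriv[OF u_ode assms] has_real_derivative_Icc_imp_deriv[OF v_ode assms] assms
  by (simp add: green_alpha_def \<alpha>_def algebra_simps)

lemma cont_\<alpha>: "continuous_on {a..b} \<alpha>"
  unfolding \<alpha>_def by (intro continuous_intros cont_u cont_v)

lemma integrable_p: "integrable (lebesgue_on {a..b}) p"
proof -
  have "(\<lambda>s. f s * (v s / \<alpha> s)) \<in> L2_on a b"
    by (intro L2_on_mult_continuous[OF f] continuous_on_divide cont_v cont_\<alpha>) (use \<alpha>_nonzero in auto)
  then show ?thesis unfolding p_def[abs_def] by (auto dest: L2_on_imp_integrable simp: mult.commute)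
qed

lemma integrable_r: "integrable (lebesgue_on {a..b}) r"
proof -
  have "(\<lambda>s. f s * (u s / \<alpha> s)) \<in> L2_on a b"
    by (intro L2_on_mult_continuous[OF f] continuous_on_divide cont_u cont_\<alpha>) (use \<alpha>_nonzero in auto)
  then show ?thesis unfolding r_def[abs_def] by (auto dest: L2_on_imp_integrable simp: mult.commute)
qed

lemma integrable_on_p: "{x..y} \<subseteq> {a..b} \<Longrightarrow> p integrable_on {x..y}"
  using integrable_subinterval[OF integrable_p] by (intro integrable_on_lebesgue_on) auto

lemma integrable_on_r: "{x..y} \<subseteq> {a..b} \<Longrightarrow> r integrable_on {x..y}"
  using integrable_subinterval[OF integrable_r] by (intro integrable_on_lebesgue_on) auto

lemma green_kernel_integral:
  assumes t: "t \<in> {a..b}"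
  shows "integrable (lebesgue_on {a..b}) (\<lambda>s. green_kernel u v t s * f s)"
    and "green_op a b u v f t = u t * A t + v t * B t"
proof -
  let ?k = "\<lambda>s. green_kernel u v t s * f s"
  \<comment> \<open>At \<open>a\<close> and \<open>b\<close> the value of \<open>green_alpha\<close>
    is unspecified, and \<open>t\<close> is where the two branches of the kernel meet.\<close>
  have N: "negligible {a, t, b}" by simp
  have eq1: "?k s = u t * p s" if "s \<in> {a..t} - {a, t, b}" for s
    using that t green_alpha_eq[of s] by (simp add: green_kernel_def p_def)
  have eq2: "?k s = v t * r s" if "s \<in> {t..b} - {a, t, b}" for s
    using that t green_alpha_eq[of s] by (simp add: green_kernel_def r_def)
  have "integrable (lebesgue_on {a..t}) (\<lambda>s. u t * p s)"
    using integrable_subinterval[OF integrable_p, of a t] t by simp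
  then have i1: "integrable (lebesgue_on {a..t}) ?k"
    by (rule integrable_lebesgue_on_spike[OF _ N eq1])
  have "integrable (lebesgue_on {t..b}) (\<lambda>s. v t * r s)"
    using integrable_subinterval[OF integrable_r, of t b] t by simp
  then have i2: "integrable (lebesgue_on {t..b}) ?k"
    by (rule integrable_lebesgue_on_spike[OF _ N eq2])
  have "set_integrable lebesgue ({a..t} \<union> {t..b}) ?k"
    using i1 i2 by (intro set_integrable_Un) (simp_all add: set_integrable_eq)
  then show int: "integrable (lebesgue_on {a..b}) ?k"
    using t by (simp add: set_integrable_eq ivl_disj_un_two_touch)
  have "green_op a b u v f t = integral {a..b} ?k"
    unfolding green_op_def by (rule lebesgue_integral_eq_integral[OF int]) simp
  also have "\<dots> = integral {a..t} ?k + integral {t..b} ?k"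
    using t int by (intro Henstock_Kurzweil_Integration.integral_combine[symmetric] integrable_on_lebesgue_on) auto
  also have "integral {a..t} ?k = integral {a..t} (\<lambda>s. u t * p s)"
    by (rule integral_spike[OF N]) (use eq1 in auto)
  also have "integral {t..b} ?k = integral {t..b} (\<lambda>s. v t * r s)"
    by (rule integral_spike[OF N]) (use eq2 in auto)
  finally show "green_op a b u v f t = u t * A t + v t * B t"
    by (simp add: A_def B_def)
qed

lemma B_eq: "t \<in> {a..b} \<Longrightarrow> B t = integral {a..b} r - integral {a..t} r"
  using Henstock_Kurzweil_Integration.integral_combine[of a t b r] integrable_on_r[of a b] by (simp add: B_def)

lemma cont_A: "continuous_on {a..b} A"
  unfolding A_def by (rule indefinite_integral_continuous_1[OF integrable_on_p]) simp

lemma cont_B: "continuous_on {a..b} B"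
proof -
  have "continuous_on {a..b} (\<lambda>t. integral {a..b} r - integral {a..t} r)"
    by (intro continuous_intros indefinite_integral_continuous_1[OF integrable_on_r]) simp
  then show ?thesis by (rule continuous_on_eq) (simp add: B_eq)
qed

lemma cont_\<psi>: "continuous_on {a..b} \<psi>"
  unfolding \<psi>_def by (intro continuous_intros cont_u cont_v cont_A cont_B w)

text \<open>The terms with \<open>u p\<close> and \<open>v r\<close>, both equal to \<open>u v f / \<alpha>\<close>, cancel.\<close>

lemma green_op_eq_integral:
  assumes t: "t \<in> {a..b}"
  shows "green_op a b u v f t = B a + integral {a..t} \<psi>"
proof -
  have sub: "{a..t} \<subseteq> {a..b}" using t by auto
  have du: "(u has_real_derivative (u s * w s + c)) (at s within {a..t})" if "s \<in> {a..t}" for s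
    using has_field_derivative_subset[OF u_ode sub] that sub by auto
  have dv: "(v has_real_derivative (v s * w s + d)) (at s within {a..t})" if "s \<in> {a..t}" for s
    using has_field_derivative_subset[OF v_ode sub] that sub by auto
  have cu': "continuous_on {a..b} (\<lambda>s. u s * w s + c)" and cv': "continuous_on {a..b} (\<lambda>s. v s * w s + d)"
    by (intro continuous_intros cont_u cont_v w)+
  \<comment> \<open>Writing \<open>B s\<close> as \<open>R b - R s\<close> makes both
    antiderivatives start at \<open>a\<close>, the form needed for integration by parts. The
    constant \<open>R b\<close> is then multiplied by the integral of \<open>v'\<close>, which is
    \<open>v t - 1\<close>.\<close>
  define R where "R = (\<lambda>t. integral {a..t} r)"
  have cR: "continuous_on {a..b} R"
    unfolding R_def by (rule indefinite_integral_continuous_1[OF integrable_on_r]) simp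
  have I1: "integral {a..t} (\<lambda>s. (u s * w s + c) * A s) = u t * A t - integral {a..t} (\<lambda>s. u s * p s)"
    unfolding A_def
    by (rule integral_deriv_times_indefinite[OF du continuous_on_subset[OF cu' sub] integrable_subinterval[OF integrable_p sub]])
  have I2: "integral {a..t} (\<lambda>s. (v s * w s + d) * R s) = v t * R t - integral {a..t} (\<lambda>s. v s * r s)"
    unfolding R_def
    by (rule integral_deriv_times_indefinite[OF dv continuous_on_subset[OF cv' sub] integrable_subinterval[OF integrable_r sub]])
  have up: "(\<lambda>s. u s * p s) = (\<lambda>s. v s * r s)" by (simp add: fun_eq_iff p_def r_def)
  have "((\<lambda>s. v s * w s + d) has_integral (v t - v a)) {a..t}"
    by (rule fundamental_theorem_of_calculus)
      (use t dv in \<open>auto simp: has_real_derivative_iff_has_vector_derivative[symmetric]\<close>)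
  then have I3: "integral {a..t} (\<lambda>s. (v s * w s + d) * R b) = (v t - 1) * R b"
    and i3: "(\<lambda>s. (v s * w s + d) * R b) integrable_on {a..t}"
    using has_integral_mult_left[of "\<lambda>s. v s * w s + d" _ _ "R b"] bc
    by (auto intro: integral_unique)
  have i1: "(\<lambda>s. (u s * w s + c) * A s) integrable_on {a..t}"
    by (intro integrable_continuous_real continuous_on_mult continuous_on_subset[OF cu' sub]
        continuous_on_subset[OF cont_A sub])
  have i2: "(\<lambda>s. (v s * w s + d) * R s) integrable_on {a..t}"
    by (intro integrable_continuous_real continuous_on_mult continuous_on_subset[OF cv' sub]
        continuous_on_subset[OF cR sub])
  have "integral {a..t} \<psi> = integral {a..t} (\<lambda>s. (u s * w s + c) * A s + ((v s * w s + d) * R b - (v s * w s + d) * R s))"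
    by (rule integral_cong) (use sub B_eq in \<open>auto simp: \<psi>_def R_def right_diff_distrib subset_iff\<close>)
  also have "\<dots> = integral {a..t} (\<lambda>s. (u s * w s + c) * A s)
      + (integral {a..t} (\<lambda>s. (v s * w s + d) * R b) - integral {a..t} (\<lambda>s. (v s * w s + d) * R s))"
    using i1 i2 i3 by (simp only: Henstock_Kurzweil_Integration.integral_add
        Henstock_Kurzweil_Integration.integral_diff integrable_diff)
  also have "\<dots> = u t * A t + v t * (R b - R t) - R b"
    unfolding I1 I2 I3 up by (simp add: algebra_simps)
  finally have "B a + integral {a..t} \<psi> = u t * A t + v t * B t"
    using B_eq[OF t] B_eq[of a] ab by (simp add: R_def)
  then show ?thesis using green_kernel_integral(2)[OF t] by simp
qed

text \<open>After the cancellation only the continuous integrand \<open>\<psi>\<close> is left, so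
  differentiability holds at every point even where \<open>A\<close> or \<open>B\<close> has no
  derivative.\<close>

lemma green_op_has_derivative:
  assumes t: "t \<in> {a..b}"
  shows "(green_op a b u v f has_real_derivative \<psi> t) (at t within {a..b})"
proof -
  have "((\<lambda>t. B a + integral {a..t} \<psi>) has_real_derivative \<psi> t) (at t within {a..b})"
    using integral_has_real_derivative[OF cont_\<psi> t] by (auto intro!: derivative_eq_intros)
  then show ?thesis
    by (rule has_field_derivative_transform_within[where d = 1]) (use t in \<open>auto simp: green_op_eq_integral\<close>)
qed

lemma deriv_green_op: "t \<in> {a<..<b} \<Longrightarrow> deriv (green_op a b u v f) t = \<psi> t"
  by (rule has_real_derivative_Icc_imp_deriv[OF green_op_has_derivative]) auto

lemma deriv_green_op_L2: "deriv (green_op a b u v f) \<in> L2_on a b"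
  by (rule L2_on_spike[OF continuous_on_imp_L2_on[OF cont_\<psi>], of "{a, b}"]) (auto intro: deriv_green_op)

lemma green_op_in_form_dom: "green_op a b u v f \<in> form_dom a b"
proof -
  obtain C where C: "\<And>t. t \<in> {a..b} \<Longrightarrow> \<bar>\<psi> t\<bar> \<le> C"
    using continuous_on_Icc_bounded[OF cont_\<psi>] by blast
  have "abs_cont_on a b (green_op a b u v f)"
  proof (rule lipschitz_imp_abs_cont_on)
    fix x y assume "x \<in> {a..b}" "y \<in> {a..b}"
    then show "\<bar>green_op a b u v f x - green_op a b u v f y\<bar> \<le> C * \<bar>x - y\<bar>"
      using field_differentiable_bound[of "{a..b}" "green_op a b u v f" \<psi> C] green_op_has_derivative C
      by simp
  qed
  with deriv_green_op_L2 show ?thesis by (simp add: form_dom_def)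
qed

text \<open>In the difference the terms with \<open>w\<close> cancel and \<open>c A + d B\<close>
  remains. Since \<open>A\<close> and \<open>B\<close> are antiderivatives of \<open>p\<close> and
  \<open>- r\<close>, its increment over \<open>{a..t}\<close> is the integral of
  \<open>c p - d r\<close>.\<close>

lemma green_op_flux:
  assumes t: "t \<in> {a..b}"
  shows "\<psi> t - green_op a b u v f t * w t = d * B a + integral {a..t} f"
proof -
  have sub: "{a..t} \<subseteq> {a..b}" using t by auto
  \<comment> \<open>The numerators add up to \<open>(c v - d u) f\<close>, that is
    \<open>\<alpha> f\<close>; this is the purpose of the denominator in the Green kernel.\<close>
  have "integral {a..t} f = integral {a..t} (\<lambda>s. c * p s - d * r s)"
  proof (rule integral_cong)
    fix s assume "s \<in> {a..t}"
    then have "\<alpha> s \<noteq> 0" using sub \<alpha>_nonzero by blast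
    then have "f s = \<alpha> s * f s / \<alpha> s" by simp
    also have "\<dots> = c * p s - d * r s"
      unfolding p_def r_def by (subst \<alpha>_def) (simp add: diff_divide_distrib left_diff_distrib mult.assoc)
    finally show "f s = c * p s - d * r s" .
  qed
  also have "\<dots> = c * A t - d * (B a - B t)"
  proof (rule integral_unique)
    have "integral {a..t} r = B a - B t" using B_eq[OF t] B_eq[of a] ab by simp
    then have "(r has_integral (B a - B t)) {a..t}"
      using integrable_integral[OF integrable_on_r[OF sub]] by simp
    moreover have "(p has_integral A t) {a..t}"
      unfolding A_def by (rule integrable_integral[OF integrable_on_p[OF sub]])
    ultimately show "((\<lambda>s. c * p s - d * r s) has_integral (c * A t - d * (B a - B t))) {a..t}"
      by (intro has_integral_diff has_integral_mult_right)
  qed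
  finally show ?thesis
    using green_kernel_integral(2)[OF t] by (simp add: \<psi>_def algebra_simps)
qed

text \<open>The flux of the Green operator is the constant \<open>d * B a\<close> plus an
  antiderivative of \<open>f\<close>. The constant is orthogonal to \<open>deriv h\<close> because
  \<open>h\<close> vanishes at both ends. In the other term Fubini turns \<open>deriv h\<close> into
  \<open>h b - h s\<close>, which is \<open>- h s\<close>, and this sign meets the one in the weak
  form.\<close>

lemma weak_form_green_op:
  assumes h: "h \<in> H1 a b"
  shows "weak_form a b w (green_op a b u v f) h = L2_inner a b f h"
proof -
  let ?L = "lebesgue_on {a..b}" and ?T = "green_op a b u v f"
  have ac: "abs_cont_on a b h" and h': "deriv h \<in> L2_on a b" and h0: "h a = 0" "h b = 0"
    using h by (auto simp: H1_def)
  have ih': "integrable ?L (deriv h)" by (rule L2_on_imp_integrable[OF h'])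
  have if': "integrable ?L f" by (rule L2_on_imp_integrable[OF f])
  have cT: "continuous_on {a..b} ?T" by (rule DERIV_continuous_on) (rule green_op_has_derivative)
  have i1: "integrable ?L (\<lambda>t. deriv ?T t * deriv h t)"
    by (rule L2_on_mult_integrable[OF deriv_green_op_L2 h'])
  have i2: "integrable ?L (\<lambda>t. ?T t * deriv h t * w t)"
    using L2_on_mult_integrable[OF continuous_on_imp_L2_on h', of "\<lambda>t. ?T t * w t"]
    by (simp add: mult_ac continuous_on_mult cT w)
  have "f integrable_on {a..b}" using if' by (intro integrable_on_lebesgue_on) auto
  then have "continuous_on {a..b} (\<lambda>t. integral {a..t} f)" by (rule indefinite_integral_continuous_1)
  then have i3: "integrable ?L (\<lambda>t. deriv h t * integral {a..t} f)"
    by (intro L2_on_mult_integrable h' continuous_on_imp_L2_on)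
  have h_int: "integral {s..b} (deriv h) = - h s" if s: "s \<in> {a..b}" for s
  proof -
    have "integral {a..s} (deriv h) = h s" "integral {a..b} (deriv h) = 0"
      using abs_cont_on_FTC(2)[OF less_imp_le[OF ab] ac s]
        abs_cont_on_FTC(2)[OF less_imp_le[OF ab] ac, of b] ab h0
      by (auto intro: integral_unique)
    moreover have "deriv h integrable_on {a..b}" using ih' by (intro integrable_on_lebesgue_on) auto
    ultimately show ?thesis
      using Henstock_Kurzweil_Integration.integral_combine[of a s b "deriv h"] s by auto
  qed
  have "weak_form a b w ?T h = - (LINT t|?L. deriv ?T t * deriv h t - ?T t * deriv h t * w t)"
    using i1 i2 by (simp add: weak_form_def)
  also have "(LINT t|?L. deriv ?T t * deriv h t - ?T t * deriv h t * w t)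
      = (LINT t|?L. d * B a * deriv h t + deriv h t * integral {a..t} f)"
  proof (rule integral_cong_AE)
    show "AE t in ?L. deriv ?T t * deriv h t - ?T t * deriv h t * w t
        = d * B a * deriv h t + deriv h t * integral {a..t} f"
      using AE_lebesgue_on_notin[of "{a, b}" a b] AE_space
    proof (rule eventually_elim2)
      fix t assume t: "t \<notin> {a, b}" "t \<in> space ?L"
      have "deriv ?T t * deriv h t - ?T t * deriv h t * w t = (\<psi> t - ?T t * w t) * deriv h t"
        using deriv_green_op[of t] t by (simp add: algebra_simps)
      also have "\<psi> t - ?T t * w t = d * B a + integral {a..t} f" using green_op_flux[of t] t by simp
      finally show "deriv ?T t * deriv h t - ?T t * deriv h t * w t
          = d * B a * deriv h t + deriv h t * integral {a..t} f"
        by (simp add: algebra_simps)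
    qed simp
  qed (use i1 i2 i3 ih' in auto)
  also have "\<dots> = d * B a * (LINT t|?L. deriv h t) + (LINT t|?L. deriv h t * integral {a..t} f)"
    using ih' i3 by simp
  also have "(LINT t|?L. deriv h t) = integral {a..b} (deriv h)"
    by (rule lebesgue_integral_eq_integral[OF ih']) simp
  also have "\<dots> = 0" using h_int[of a] ab h0 by simp
  also have "(LINT t|?L. deriv h t * integral {a..t} f) = (LINT s|?L. f s * integral {s..b} (deriv h))"
    by (rule integral_by_parts_indefinite[OF if' ih'])
  also have "\<dots> = (LINT s|?L. - (f s * h s))"
    by (rule Bochner_Integration.integral_cong) (simp_all add: h_int)
  finally show ?thesis by (simp add: L2_inner_def)
qed

end

text \<open>Integrals of non-integrable functions have the default value 0. The conjuncts on
  integrability of the kernel and on membership in \<open>form_dom\<close> ensure that the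
  identities are about genuine integrals.\<close>

theorem theorem5:
  fixes M :: "'w measure" and a b :: real and W u v :: "real \<Rightarrow> 'w \<Rightarrow> real"
    and f h :: "real \<Rightarrow> real"
  assumes "prob_space M" and "a < b"
    and "brownian_motion_on M a b W"
    and "weak_solution M a b W u" and "weak_solution M a b W v"
    and "\<And>\<omega>. \<omega> \<in> space M \<Longrightarrow> u a \<omega> = 0" and "\<And>\<omega>. \<omega> \<in> space M \<Longrightarrow> u b \<omega> = 1"
    and "\<And>\<omega>. \<omega> \<in> space M \<Longrightarrow> v a \<omega> = 1" and "\<And>\<omega>. \<omega> \<in> space M \<Longrightarrow> v b \<omega> = 0"
    and "f \<in> L2_on a b" and "h \<in> H1 a b"
  shows "AE \<omega> in M.
    let U = (\<lambda>t. u t \<omega>); V = (\<lambda>t. v t \<omega>); w = (\<lambda>t. W t \<omega>); Tf = green_op a b U V f in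
      (\<forall>t\<in>{a..b}. integrable (lebesgue_on {a..b}) (\<lambda>s. green_kernel U V t s * f s)) \<and>
      Tf \<in> form_dom a b \<and>
      weak_form a b w Tf h = weak_L a b w Tf h \<and>
      weak_L a b w Tf h = L2_inner a b f h"
proof -
  have test: "AE \<omega> in M. \<forall>q\<in>\<rat> \<inter> {a..b}. weak_form a b (\<lambda>t. W t \<omega>) (\<lambda>t. y t \<omega>) (hat a b q) = 0"
    if "weak_solution M a b W y" for y
  proof (subst AE_ball_countable)
    show "countable (\<rat> \<inter> {a..b})" by (simp add: countable_rat)
    show "\<forall>q\<in>\<rat> \<inter> {a..b}. AE \<omega> in M. weak_form a b (\<lambda>t. W t \<omega>) (\<lambda>t. y t \<omega>) (hat a b q) = 0"
      using that hat_in_H1[OF \<open>a < b\<close>] by (auto simp: weak_solution_def weak_L_def)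
  qed
  show ?thesis
    using test[OF assms(4)] test[OF assms(5)] AE_space[of M]
  proof eventually_elim
    case (elim \<omega>)
    let ?U = "\<lambda>t. u t \<omega>" and ?V = "\<lambda>t. v t \<omega>" and ?w = "\<lambda>t. W t \<omega>"
    have w: "continuous_on {a..b} ?w"
      using assms(3) elim(3) by (auto simp: brownian_motion_on_def)
    have dom: "?U \<in> form_dom a b" "?V \<in> form_dom a b"
      using assms(4,5) elim(3) by (auto simp: weak_solution_def)
    obtain c where c: "\<And>t. t \<in> {a..b} \<Longrightarrow> (?U has_real_derivative (?U t * ?w t + c)) (at t within {a..b})"
      using weak_solution_imp_ode[OF \<open>a < b\<close> w dom(1)] elim(1) by blast
    obtain d where d: "\<And>t. t \<in> {a..b} \<Longrightarrow> (?V has_real_derivative (?V t * ?w t + d)) (at t within {a..b})"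
      using weak_solution_imp_ode[OF \<open>a < b\<close> w dom(2)] elim(2) by blast
    \<comment> \<open>The constants \<open>c\<close> and \<open>d\<close> were obtained for this
      \<open>\<omega>\<close> and depend on it; the rest of the argument concerns this single
      path.\<close>
    interpret green_path a b c d ?w ?U ?V f
      by unfold_locales (use assms(2,6-10) w c d elim(3) in auto)
    show ?case
      unfolding Let_def weak_L_def
      using green_kernel_integral(1) green_op_in_form_dom weak_form_green_op[OF assms(11)] by blast
  qed
qed

end
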